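(* Let $k \ge 3$, let $x_1 < \dots < x_k$ be real numbers and let $\mathbf{p} = (p_1,\dots,p_k)$ be a probability vector with $p_i > 0$ for all $i$. Put $f_i := \sum_{j \le i} p_j$ for $i = 0,\dots,k$, let $$ d_i := \frac{\log \frac{1-f_i}{1-f_{i-1}}}{\log \frac{f_{i-1}(1-f_i)}{(1-f_{i-1}) f_i}}, \qquad i = 2,\dots,k-1, $$ and set $d_1 := 0$, $d_k := 1$. Then any optimal policy (that is, any choice of optimal locations $\ell_N(i)$, $N \ge 1$, $1 \le i \le k$, for the sequential assignment problem with distribution $\mathbf{p}$ on $x_1,\dots,x_k$) satisfies $$ \ell_N(i) = N\,(d_i + o(1)), \qquad \text{as } N \to \infty,\quad i = 1,\dots,k. $$
   Context: Sequential assignment problem: let $N \ge 1$ and let $r_N > \dots > r_1$ be given real numbers (rewards of locations $N,\dots,1$). Let $X_1,\dots,X_N$ be i.i.d. with $\mathbf{P}[X_t = x_i] = p_i$, $1 \le i \le k$, and let $\mathcal{F}_t = \sigma\{X_1,\dots,X_t\}$. A policy is a sequence of random indices $J(1),\dots,J(N) \in \{1,\dots,N\}$ such that $J(t)$ is $\mathcal{F}_t$-measurable and $J(1),\dots,J(N)$ are distinct. Its reward is $R(X;J) = \sum_{t=1}^N X_t r_{J(t)}$; a policy is optimal if it maximizes the expected reward $\mathbf{E}[R(X;J)]$. Optimal locations: $\ell_N(i) \in \{1,\dots,N\}$ denotes an optimal location for placing the value $x_i$ when there are $N$ empty spaces (and $N$ rounds to go), i.e. an index such that some optimal policy with $N$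 rounds has $J(1) = \ell_N(i)$ on the event $\{X_1 = x_i\}$. By a theorem of Derman, Lieberman and Ross, the optimal locations depend only on $\mathbf{p}$ and $(x_i)_{i=1}^k$ and not on the rewards $r_j$; when there are ties an arbitrary choice is made. One has $1 = \ell_N(1) \le \ell_N(2) \le \dots \le \ell_N(k) = N$. *)

theory Defs
  imports "HOL-Probability.Probability" "HOL-Library.Landau_Symbols"
begin

text \<open>The sequential assignment problem with \<open>N\<close> rounds: \<open>X 1, \<dots>, X N\<close> are random variables on
  \<open>M\<close>, and \<open>r 1 < \<dots> < r N\<close> are the rewards of the locations \<open>1, \<dots>, N\<close>.  Values \<open>x i\<close> and
  probabilities \<open>p i\<close> are indexed by \<open>i \<in> {1..k}\<close>; other arguments of these functions are
  irrelevant.\<close>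

definition iid_with_pmf ::
  "'a measure \<Rightarrow> nat \<Rightarrow> nat \<Rightarrow> (nat \<Rightarrow> real) \<Rightarrow> (nat \<Rightarrow> real) \<Rightarrow> (nat \<Rightarrow> 'a \<Rightarrow> real) \<Rightarrow> bool"
  where
  "iid_with_pmf M N k x p X \<longleftrightarrow>
     prob_space M \<and>
     prob_space.indep_vars M (\<lambda>_. borel) X {1..N} \<and>
     (\<forall>t\<in>{1..N}. \<forall>i\<in>{1..k}. measure M {\<omega> \<in> space M. X t \<omega> = x i} = p i)"

definition history :: "'a measure \<Rightarrow> (nat \<Rightarrow> 'a \<Rightarrow> real) \<Rightarrow> nat \<Rightarrow> 'a measure" where
  "history M X t =
     sigma (space M) (\<Union>s\<in>{1..t}. {X s -` A \<inter> space M | A. A \<in> sets borel})"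

definition policy :: "'a measure \<Rightarrow> nat \<Rightarrow> (nat \<Rightarrow> 'a \<Rightarrow> real) \<Rightarrow> (nat \<Rightarrow> 'a \<Rightarrow> nat) \<Rightarrow> bool" where
  "policy M N X J \<longleftrightarrow>
     (\<forall>t\<in>{1..N}. J t \<in> history M X t \<rightarrow>\<^sub>M count_space {1..N}) \<and>
     (\<forall>\<omega>\<in>space M. inj_on (\<lambda>t. J t \<omega>) {1..N})"

definition reward ::
  "nat \<Rightarrow> (nat \<Rightarrow> real) \<Rightarrow> (nat \<Rightarrow> 'a \<Rightarrow> real) \<Rightarrow> (nat \<Rightarrow> 'a \<Rightarrow> nat) \<Rightarrow> 'a \<Rightarrow> real" where
  "reward N r X J \<omega> = (\<Sum>t = 1..N. X t \<omega> * r (J t \<omega>))"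

definition optimal_policy ::
  "'a measure \<Rightarrow> nat \<Rightarrow> (nat \<Rightarrow> real) \<Rightarrow> (nat \<Rightarrow> 'a \<Rightarrow> real) \<Rightarrow> (nat \<Rightarrow> 'a \<Rightarrow> nat) \<Rightarrow> bool" where
  "optimal_policy M N r X J \<longleftrightarrow>
     policy M N X J \<and>
     (\<forall>J'. policy M N X J' \<longrightarrow>
        integral\<^sup>L M (reward N r X J') \<le> integral\<^sup>L M (reward N r X J))"

text \<open>Ties are allowed: several locations \<open>l\<close> may be optimal for the same value \<open>v\<close>.\<close>

definition optimal_location ::
  "'a measure \<Rightarrow> nat \<Rightarrow> (nat \<Rightarrow> real) \<Rightarrow> (nat \<Rightarrow> 'a \<Rightarrow> real) \<Rightarrow> real \<Rightarrow> nat \<Rightarrow> bool" where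
  "optimal_location M N r X v l \<longleftrightarrow>
     l \<in> {1..N} \<and>
     (\<exists>J. optimal_policy M N r X J \<and> (\<forall>\<omega>\<in>space M. X 1 \<omega> = v \<longrightarrow> J 1 \<omega> = l))"

definition cum_prob :: "(nat \<Rightarrow> real) \<Rightarrow> nat \<Rightarrow> real" where
  "cum_prob p i = (\<Sum>j = 1..i. p j)"

definition limit_location :: "nat \<Rightarrow> (nat \<Rightarrow> real) \<Rightarrow> nat \<Rightarrow> real" where
  "limit_location k p i =
     (if i = 1 then 0
      else if i = k then 1
      else ln ((1 - cum_prob p i) / (1 - cum_prob p (i - 1))) /
           ln (cum_prob p (i - 1) * (1 - cum_prob p i) /
               ((1 - cum_prob p (i - 1)) * cum_prob p i)))"

end

theory Submission imports Defs "HOL-Real_Asymp.Real_Asymp"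
begin

text \<open>Derman, Lieberman and Ross: let \<open>thr n j\<close> be the expected value that optimal play puts into the
  \<open>j\<close>-th smallest of \<open>n\<close> empty locations; it does not involve the rewards.  A value \<open>y\<close> that arrives
  with \<open>n\<close> further rounds to go should take its place in the sorted order of
  \<open>thr n 1 \<le> \<dots> \<le> thr n n\<close>, because the rearrangement inequality matches the sorted expected values
  with the sorted rewards (\<open>insertion_le\<close>, \<open>insertion_eq_iff\<close>).  The \<open>j\<close>-th smallest element of
  these numbers together with \<open>y\<close> is \<open>y\<close> clamped to \<open>[thr n (j - 1), thr n j]\<close>, and averaging over
  \<open>y\<close> gives \<open>thr (n + 1) j\<close>.  A telescoping argument over the rounds writes the loss of any policy as
  a sum of nonnegative expected gaps, all of which vanish for an optimal policy
  (\<open>expected_reward\<close>, \<open>optimal_gap_zero\<close>).  Hence an optimal location \<open>l\<close> for \<open>x i\<close> satisfies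
  \<open>thr (N - 1) (l - 1) \<le> x i \<le> thr (N - 1) l\<close> (\<open>optimal_location_between\<close>), and it remains to find
  where the nondecreasing sequence \<open>thr N\<close> crosses the level \<open>x i\<close>.

  Write \<open>f\<close> and \<open>F\<close> for the cumulative probabilities of \<open>i - 1\<close> and \<open>i\<close>.  Between the levels
  \<open>x (i - 1)\<close> and \<open>x i\<close> the recursion for \<open>thr\<close> is the linear equation of a random walk that moves with
  probability \<open>f\<close>; between \<open>x i\<close> and \<open>x (i + 1)\<close> it is that of a walk that moves with probability
  \<open>F\<close>.  At a position \<open>u * N\<close> with \<open>f < u < F\<close> a positive value of \<open>thr N - x i\<close> is therefore at most
  about the probability that a binomial variable with parameter \<open>F\<close> stays below \<open>u * N\<close>, and a negative
  one is at least, in absolute value, about the probability that a binomial variable with parameter \<open>f\<close>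
  exceeds \<open>u * N\<close>.  Both decay exponentially, with the relative entropies of \<open>u\<close> with respect to \<open>F\<close>
  and to \<open>f\<close> as rates.  The slower decay decides the sign, and the rates agree exactly at
  \<open>u = limit_location k p i\<close>.

  The heuristic becomes a proof in \<open>negative_below_balance\<close>: after a long initial time one follows a
  line of slope \<open>P / Q\<close> below the balance point, in blocks of \<open>Q\<close> steps.  Each block multiplies the
  negative amount on the line by at least a binomial probability \<open>q\<close>, while the positive error falls by
  a factor \<open>\<sigma> < q\<close>, so that the errors never catch up.  The side above the balance point follows by
  reflecting values and positions.\<close>

section \<open>The balance point of two binomial rates\<close>

text \<open>The number \<open>u\<close> at which the relative entropies of \<open>u\<close> with respect to \<open>f\<close> and to \<open>F\<close> agree:
  the difference of the two is affine in \<open>u\<close>, namely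
  \<open>u * ln (F / f) - (1 - u) * ln ((1 - f) / (1 - F))\<close>.\<close>

definition balance :: "real \<Rightarrow> real \<Rightarrow> real" where
  "balance f F = ln ((1 - F) / (1 - f)) / ln (f * (1 - F) / ((1 - f) * F))"

lemma balance_eq:
  assumes "0 < f" "f < F" "F < 1"
  shows "balance f F = ln ((1 - f) / (1 - F)) / (ln ((1 - f) / (1 - F)) + ln (F / f))"
proof -
  have 1: "ln ((1 - F) / (1 - f)) = - ln ((1 - f) / (1 - F))"
    using assms by (simp add: ln_div)
  have 2: "ln (f * (1 - F) / ((1 - f) * F)) = - (ln ((1 - f) / (1 - F)) + ln (F / f))"
    using assms by (simp add: ln_div ln_mult)
  show ?thesis unfolding balance_def 1 2 by (simp only: minus_divide_divide)
qed

lemma balance_pos: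
  assumes "0 < f" "f < F" "F < 1"
  shows "0 < balance f F"
proof -
  have "ln ((1 - f) / (1 - F)) > 0" "ln (F / f) > 0" using assms by (auto intro!: ln_gt_zero)
  thus ?thesis by (simp add: balance_eq[OF assms])
qed

text \<open>Both logarithms are compared with their tangent at \<open>1\<close>; after clearing denominators the two tangent
  bounds meet in \<open>F - f\<close>.\<close>

lemma balance_less:
  assumes "0 < f" "f < F" "F < 1"
  shows "balance f F < F"
proof -
  let ?B = "ln ((1 - f) / (1 - F))" and ?A = "ln (F / f)"
  have pos: "?B > 0" "?A > 0" using assms by (auto intro!: ln_gt_zero)
  have "?B \<le> (1 - f) / (1 - F) - 1" using assms by (intro ln_le_minus_one) auto
  hence B: "(1 - F) * ?B \<le> F - f" using assms by (simp add: field_simps)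
  have "ln (f / F) < f / F - 1"
    using assms ln_le_minus_one[of "f/F"] ln_eq_minus_one[of "f/F"] by fastforce
  hence "?A > 1 - f / F" using assms by (simp add: ln_div)
  hence "F * ?A > F * (1 - f / F)" using assms by (intro mult_strict_left_mono) auto
  also have "F * (1 - f / F) = F - f" using assms by (simp add: right_diff_distrib)
  finally have "F * ?A > F - f" .
  with B have "?B < F * (?B + ?A)" by (simp add: algebra_simps)
  thus ?thesis using pos by (simp add: balance_eq[OF assms] field_simps)
qed

text \<open>Exchanging success and failure turns the parameters \<open>f < F\<close> into \<open>1 - F < 1 - f\<close>; this is what
  carries a bound below the balance point over to one above it.\<close>

lemma balance_reflect:
  assumes "0 < f" "f < F" "F < 1"
  shows "balance (1 - F) (1 - f) = 1 - balance f F"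
proof -
  have pos: "ln ((1 - f) / (1 - F)) > 0" "ln (F / f) > 0" using assms by (auto intro!: ln_gt_zero)
  have "balance (1 - F) (1 - f) = ln (F / f) / (ln (F / f) + ln ((1 - f) / (1 - F)))"
    using assms by (subst balance_eq) auto
  moreover have "balance f F = ln ((1 - f) / (1 - F)) / (ln ((1 - f) / (1 - F)) + ln (F / f))"
    using assms by (rule balance_eq)
  moreover have "a / (a + b) = 1 - b / (b + a)" if "a > 0" "b > 0" for a b :: real
    using that by (simp add: field_simps)
  ultimately show ?thesis using pos by metis
qed

text \<open>The mode of the binomial distribution with parameters \<open>Q\<close> and \<open>P / Q\<close> is \<open>P\<close>, so the
  term at \<open>P\<close> is at least the average of the \<open>Q + 1\<close> terms, which sum to \<open>1\<close>.\<close>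

lemma central_binomial_term_ge:
  fixes P Q :: nat
  assumes "0 < P" "P < Q"
  defines "u \<equiv> real P / real Q"
  shows "1 \<le> real (Q + 1) * (real (Q choose P) * u ^ P * (1 - u) ^ (Q - P))"
proof -
  define b where "b s = real (Q choose s) * u ^ s * (1 - u) ^ (Q - s)" for s
  have u: "0 < u" "u < 1" using assms by (auto simp: u_def)
  have ratio: "b (Suc s) * (real (Suc s) * (1 - u)) = b s * (real (Q - s) * u)" if "s < Q" for s
  proof -
    have "real (Suc s) * real (Q choose Suc s) = real (Q - s) * real (Q choose s)"
      using binomial_absorb_comp[of Q s] binomial_absorption[of s "Q - 1"] that
      by (metis Suc_diff_1 binomial_absorption less_nat_zero_code not_gr_zero of_nat_mult)
    moreover have "(1 - u) ^ (Q - s) = (1 - u) * (1 - u) ^ (Q - Suc s)"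
      using that by (metis Suc_diff_Suc power_Suc)
    ultimately have "(real (Suc s) * real (Q choose Suc s)) * (u * u ^ s * ((1 - u) * (1 - u) ^ (Q - Suc s)))
        = (real (Q - s) * real (Q choose s)) * (u * u ^ s * (1 - u) ^ (Q - s))" by simp
    thus ?thesis unfolding b_def by (simp only: power_Suc mult_ac)
  qed
  have b_pos: "b s > 0" if "s \<le> Q" for s using u that by (auto simp: b_def)
  have up: "b s \<le> b (Suc s)" if "s < P" for s
  proof -
    have "real (Suc s) * (1 - u) \<le> real (Q - s) * u"
    proof -
      have "real (Suc s) \<le> real P" using that by simp
      also have "real P = real Q * u" using assms by (simp add: u_def)
      finally have "real (Suc s) \<le> real Q * u" .
      thus ?thesis using that assms(2) u by (simp add: of_nat_diff algebra_simps)
    qed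
    hence "b (Suc s) * (real (Suc s) * (1 - u)) \<le> b (Suc s) * (real (Q - s) * u)"
      using b_pos[of "Suc s"] that assms by (intro mult_left_mono) auto
    hence "b s * (real (Q - s) * u) \<le> b (Suc s) * (real (Q - s) * u)"
      using ratio[of s] that assms(2) by simp
    moreover have "real (Q - s) * u > 0" using u that assms(2) by simp
    ultimately show ?thesis by (simp only: mult_le_cancel_right_pos)
  qed
  have down: "b (Suc s) \<le> b s" if "P \<le> s" "s < Q" for s
  proof -
    have "real (Q - s) * u \<le> real (Suc s) * (1 - u)"
    proof -
      have "real Q * u = real P" using assms by (simp add: u_def)
      also have "... \<le> real s" using that by simp
      finally show ?thesis using that u by (simp add: of_nat_diff algebra_simps)
    qed
    hence "b s * (real (Q - s) * u) \<le> b s * (real (Suc s) * (1 - u))"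
      using b_pos[of s] that by (intro mult_left_mono) auto
    hence "b (Suc s) * (real (Suc s) * (1 - u)) \<le> b s * (real (Suc s) * (1 - u))"
      using ratio[of s] that by simp
    moreover have "real (Suc s) * (1 - u) > 0" using u by simp
    ultimately show ?thesis by (simp only: mult_le_cancel_right_pos)
  qed
  have "b s \<le> b P" if "s \<le> Q" for s
  proof (cases "s \<le> P")
    case True thus ?thesis
      by (induction rule: inc_induct) (auto intro: order_trans up)
  next
    case False
    hence "P \<le> s" by simp
    thus ?thesis using that
      by (induction rule: dec_induct) (auto intro: order_trans[OF down])
  qed
  hence "(\<Sum>s\<le>Q. b s) \<le> (\<Sum>s\<le>Q. b P)" by (intro sum_mono) auto
  moreover have "(\<Sum>s\<le>Q. b s) = 1"
    using binomial_ring[of u "1 - u" Q] by (simp add: b_def)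
  ultimately show ?thesis by (simp add: b_def algebra_simps)
qed

text \<open>The right-hand side of the last inequality is a lower bound for the probability that a binomial
  variable with parameter \<open>f\<close> reaches \<open>P\<close> in \<open>Q\<close> steps; the left-hand side is the Chernoff bound for
  the probability that one with parameter \<open>F\<close> does not exceed \<open>P\<close>.  Below the balance point the
  former decays at the smaller exponential rate, so it wins for blocks that are long enough: the
  ratio is \<open>exp (n * \<eta>)\<close> up to a factor that is at most linear in the block length.\<close>

lemma block_exists:
  assumes fF: "0 < f" "f < F" "F < 1" and u: "u < balance f F"
  obtains P Q :: nat and y :: real
  where "0 < Q" "u < real P / real Q" "0 < y" "y < 1"
    "(1 - F + F * y) ^ Q / y ^ P < real (Q choose P) * f ^ P * (1 - f) ^ (Q - P)"
proof -
  let ?B = "ln ((1 - f) / (1 - F))" and ?A = "ln (F / f)"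
  have pos: "?B > 0" "?A > 0" using fF by (auto intro!: ln_gt_zero)
  have "max u 0 < balance f F" using u balance_pos[OF fF] by simp
  then obtain v where "v \<in> \<rat>" "max u 0 < v" "v < balance f F"
    using Rats_dense_in_real by blast
  then obtain P0 Q0 :: nat where v: "v = real P0 / real Q0" "Q0 \<noteq> 0"
    using Rats_abs_nat_div_natE[of v] by (metis abs_of_pos max_less_iff_conj)
  have v': "u < v" "0 < v" "v < balance f F" "v < F" "v < 1"
    using \<open>max u 0 < v\<close> \<open>v < balance f F\<close> balance_less[OF fF] fF by auto
  have "real P0 = v * real Q0" using v by simp
  hence "0 < real P0" "real P0 < real Q0" using v' v(2) by simp_all
  hence P0: "0 < P0" "P0 < Q0" by simp_all
  \<comment> \<open>\<open>Q0\<close> times the difference of the two relative entropies at \<open>v\<close>.\<close>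
  define \<eta> where "\<eta> = real (Q0 - P0) * ?B - real P0 * ?A"
  have eta: "\<eta> > 0"
  proof -
    have "v * (?B + ?A) < ?B" using v' pos by (simp add: balance_eq[OF fF] field_simps)
    hence "real Q0 * (v * (?B + ?A)) < real Q0 * ?B" using v(2) by simp
    moreover have "real Q0 * v = real P0" using v by simp
    ultimately have "real P0 * (?B + ?A) < real Q0 * ?B" by (metis mult.assoc)
    thus ?thesis using P0 by (simp add: \<eta>_def of_nat_diff algebra_simps)
  qed
  have "eventually (\<lambda>n. real (n * Q0 + 1) < exp (real n * \<eta>)) sequentially"
    using eta by real_asymp
  then obtain n where n: "n > 0" "real (n * Q0 + 1) < exp (real n * \<eta>)"
    using eventually_gt_at_top[of "0::nat"] by (metis (mono_tags, lifting) eventually_conj eventually_sequentially order_refl)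
  define P where "P = n * P0"
  define Q where "Q = n * Q0"
  \<comment> \<open>The optimal Chernoff parameter: tilting by it turns the mean \<open>F\<close> into \<open>v\<close>.\<close>
  define y where "y = v * (1 - F) / ((1 - v) * F)"
  have PQ: "0 < P" "P < Q" using P0 n by (auto simp: P_def Q_def)
  have vPQ: "v = real P / real Q" using v n by (simp add: P_def Q_def)
  have y: "0 < y" "y < 1" using v' fF by (auto simp: y_def field_simps)
  have "1 - F + F * y = (1 - F) / (1 - v)" using v' fF by (simp add: y_def field_simps)
  hence sigma: "(1 - F + F * y) ^ Q / y ^ P = ((1 - F) / (1 - v)) ^ Q / (v / (1 - v) * ((1 - F) / F)) ^ P"
    by (simp add: y_def)
  also have "... = ((1 - F) / (1 - v)) ^ (Q - P) * ((1 - F) / (1 - v)) ^ P / (v / (1 - v) * ((1 - F) / F)) ^ P"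
    using PQ by (simp flip: power_add)
  also have "... = ((1 - F) / (1 - v)) ^ (Q - P) * (((1 - F) / (1 - v)) / (v / (1 - v) * ((1 - F) / F))) ^ P"
    by (simp only: power_divide times_divide_eq_right)
  also have "((1 - F) / (1 - v)) / (v / (1 - v) * ((1 - F) / F)) = F / v"
    using v' fF by (simp add: divide_divide_eq_left divide_divide_eq_right)
  finally have sigma: "(1 - F + F * y) ^ Q / y ^ P = ((1 - F) / (1 - v)) ^ (Q - P) * (F / v) ^ P" .
  have ex: "exp (real n * \<eta>) = ((1 - f) / (1 - F)) ^ (Q - P) / (F / f) ^ P"
  proof -
    have "real n * \<eta> = real (Q - P) * ?B - real P * ?A"
      using P0 by (simp add: \<eta>_def P_def Q_def of_nat_diff algebra_simps)
    thus ?thesis using fF by (simp add: exp_diff exp_of_nat_mult)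
  qed
  define c where "c = real (Q choose P) * v ^ P * (1 - v) ^ (Q - P)"
  have c0: "c > 0" using v' PQ by (auto simp: c_def)
  have "1 \<le> real (Q + 1) * c"
    using central_binomial_term_ge[OF PQ] by (simp add: c_def vPQ)
  also have "... < exp (real n * \<eta>) * c" using n(2) c0 by (simp add: Q_def)
  finally have "1 < exp (real n * \<eta>) * c" .
  moreover have "exp (real n * \<eta>) * c * ((1 - F + F * y) ^ Q / y ^ P)
      = real (Q choose P) * f ^ P * (1 - f) ^ (Q - P)"
    unfolding sigma ex c_def using v' fF by (simp add: power_divide)
  moreover have "(1 - F + F * y) ^ Q / y ^ P > 0" using y fF by (auto intro!: divide_pos_pos zero_less_power add_pos_pos)
  ultimately have "(1 - F + F * y) ^ Q / y ^ P < real (Q choose P) * f ^ P * (1 - f) ^ (Q - P)"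
    by (metis mult_1 mult_strict_right_mono)
  thus ?thesis using that[of Q P y] PQ y v' vPQ by auto
qed

section \<open>Competition of two walks\<close>

text \<open>An abstract version of the thresholds near one level, with time \<open>m\<close> and position \<open>j\<close>: \<open>w m j\<close> is
  a truncated difference between threshold and level.  The whole of \<open>w\<close> is a subsolution of the equation
  of a walk with parameter \<open>f\<close>, and its positive part is a subsolution of that of a walk with the larger
  parameter \<open>F\<close>.  The sign of \<open>w\<close> is decided by the competition of the two.\<close>

locale two_speed =
  fixes w :: "nat \<Rightarrow> int \<Rightarrow> real" and f F \<alpha> \<beta> :: real
  assumes fF: "0 < f" "f < F" "F < 1" and \<alpha>_pos: "0 < \<alpha>"
    and mono: "\<And>m i j. i \<le> j \<Longrightarrow> w m i \<le> w m j"
    and left: "\<And>m j. j \<le> 0 \<Longrightarrow> w m j \<le> - \<alpha>"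
    and start: "\<And>j. w 0 j \<le> \<beta>"
    and slow: "\<And>m j. w (Suc m) j \<le> f * w m (j - 1) + (1 - f) * w m j"
    and fast: "\<And>m j. max 0 (w (Suc m) j) \<le> F * max 0 (w m (j - 1)) + (1 - F) * max 0 (w m j)"
begin

lemma antimono_time:
  assumes "m \<le> n"
  shows "w n j \<le> w m j"
  using assms
proof (induction rule: dec_induct)
  case (step n)
  have "w (Suc n) j \<le> f * w n (j - 1) + (1 - f) * w n j" by (rule slow)
  also have "... \<le> f * w n j + (1 - f) * w n j"
    using fF mono[of "j - 1" j n] by (intro add_right_mono mult_left_mono) auto
  also have "... = w n j" by (simp add: algebra_simps)
  finally show ?case using step by simp
qed simp

text \<open>Iterating \<open>slow\<close> over \<open>Q\<close> steps represents \<open>w (m + Q) (j + P)\<close> as an upper bound by an average of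
  \<open>w m\<close> over the positions reached by a walk.  The positions after exactly \<open>P\<close> moves contribute their
  negative value; all others are estimated by the positive part at \<open>J\<close>.\<close>

lemma block_bound:
  assumes "w m j \<le> 0" "j + int P \<le> J"
  shows "w (m + Q) (j + int P) \<le> real (Q choose P) * f ^ P * (1 - f) ^ (Q - P) * w m j + max 0 (w m J)"
  using assms(2)
proof (induction Q arbitrary: P)
  case 0
  show ?case using mono[OF 0, of m] assms(1) by (cases P) auto
next
  case (Suc Q)
  let ?b = "\<lambda>Q P. real (Q choose P) * f ^ P * (1 - f) ^ (Q - P)"
  let ?e = "max 0 (w m J)"
  have "w (m + Suc Q) (j + int P) \<le> f * w (m + Q) (j + int P - 1) + (1 - f) * w (m + Q) (j + int P)"
    using slow[of "m + Q" "j + int P"] by simp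
  also have "... \<le> ?b (Suc Q) P * w m j + ?e"
  proof (cases P)
    case 0
    have "w (m + Q) (j - 1) \<le> ?e"
      using antimono_time[of m "m + Q" "j - 1"] mono[of "j - 1" J m] Suc.prems 0 by auto
    moreover have "w (m + Q) j \<le> ?b Q 0 * w m j + ?e" using Suc.IH[of 0] Suc.prems 0 by simp
    ultimately have "f * w (m + Q) (j - 1) + (1 - f) * w (m + Q) j
        \<le> f * ?e + (1 - f) * (?b Q 0 * w m j + ?e)"
      using fF by (intro add_mono mult_left_mono) auto
    thus ?thesis using 0 by (simp add: algebra_simps)
  next
    case (Suc P')
    have 1: "w (m + Q) (j + int P - 1) \<le> ?b Q P' * w m j + ?e"
      using Suc.IH[of P'] Suc.prems Suc by (simp add: algebra_simps)
    have 2: "w (m + Q) (j + int P) \<le> ?b Q P * w m j + ?e" using Suc.IH[of P] Suc.prems by simp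
    have "f * w (m + Q) (j + int P - 1) + (1 - f) * w (m + Q) (j + int P)
        \<le> f * (?b Q P' * w m j + ?e) + (1 - f) * (?b Q P * w m j + ?e)"
      using fF 1 2 by (intro add_mono mult_left_mono) auto
    also have "... = (f * ?b Q P' + (1 - f) * ?b Q P) * w m j + ?e" by (simp add: algebra_simps)
    also have "f * ?b Q P' + (1 - f) * ?b Q P = ?b (Suc Q) P"
    proof (cases "P \<le> Q")
      case True
      hence "(1 - f) * (1 - f) ^ (Q - P) = (1 - f) ^ (Q - P')"
        using Suc by (metis Suc_diff_le diff_Suc_Suc power_Suc)
      hence "(1 - f) * ?b Q P = real (Q choose P) * f ^ P * (1 - f) ^ (Q - P')" by (metis (no_types, lifting) mult.assoc mult.left_commute)
      thus ?thesis using Suc by (simp add: algebra_simps)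
    next
      case False
      thus ?thesis using Suc by (simp add: binomial_eq_0)
    qed
    finally show ?thesis .
  qed
  finally show ?case .
qed

text \<open>The right-hand side is an exponential solution of the equation with parameter \<open>F\<close> that dominates
  the initial values.\<close>

lemma chernoff:
  assumes "0 < y" "y < 1"
  shows "max 0 (w m j) \<le> max 0 \<beta> * (1 - F + F * y) ^ m * y powi (- j)"
proof (induction m arbitrary: j)
  case 0
  show ?case
  proof (cases "j \<le> 0")
    case True
    thus ?thesis using left[OF True, of 0] \<alpha>_pos assms by auto
  next
    case False
    have "1 \<le> y powi (- j)" using False assms
      by (simp add: power_int_minus one_le_inverse power_int_le_one)
    hence "max 0 \<beta> * 1 \<le> max 0 \<beta> * y powi (- j)" by (intro mult_left_mono) auto
    thus ?thesis using start[of j] by auto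
  qed
next
  case (Suc m)
  let ?C = "max 0 \<beta> * (1 - F + F * y) ^ m"
  have "max 0 (w (Suc m) j) \<le> F * max 0 (w m (j - 1)) + (1 - F) * max 0 (w m j)" by (rule fast)
  also have "... \<le> F * (?C * y powi (- (j - 1))) + (1 - F) * (?C * y powi (- j))"
    using fF Suc[of j] Suc[of "j - 1"] by (intro add_mono mult_left_mono) auto
  also have "y powi (- (j - 1)) = y * y powi (- j)"
    using assms power_int_add_1'[of y "- j"] by simp
  finally show ?case by (simp add: algebra_simps)
qed

text \<open>The line is started at position \<open>0\<close> at a late time \<open>M0\<close>.  There \<open>w\<close> is still at most \<open>- \<alpha>\<close>, while
  all later errors carry the factor \<open>\<rho> ^ M0\<close>, and this factor can be made as small as desired.\<close>

lemma negative_below_balance: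
  assumes u: "u < balance f F"
  shows "eventually (\<lambda>m. \<forall>j. real_of_int j \<le> u * real m \<longrightarrow> w m j < 0) sequentially"
proof -
  obtain P Q :: nat and y :: real where PQ: "0 < Q" "u < real P / real Q" and y: "0 < y" "y < 1"
    and gap: "(1 - F + F * y) ^ Q / y ^ P < real (Q choose P) * f ^ P * (1 - f) ^ (Q - P)"
    by (rule block_exists[OF fF u])
  define \<rho> where "\<rho> = 1 - F + F * y"
  define \<sigma> where "\<sigma> = \<rho> ^ Q / y ^ P"
  define q where "q = real (Q choose P) * f ^ P * (1 - f) ^ (Q - P)"
  have "F * y < F" using fF y by simp
  hence rho: "0 < \<rho>" "\<rho> < 1" using fF y by (auto simp: \<rho>_def intro!: add_pos_pos)
  have sigma: "0 < \<sigma>" "\<sigma> < q" using rho y gap by (auto simp: \<sigma>_def q_def \<rho>_def)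
  define C where "C = max 0 \<beta> / y ^ P"
  have C: "C \<ge> 0" using y by (simp add: C_def)
  have "(\<lambda>m. C / (q - \<sigma>) * \<rho> ^ m) \<longlonglongrightarrow> C / (q - \<sigma>) * 0"
    using rho by (intro tendsto_mult tendsto_const LIMSEQ_realpow_zero) auto
  hence "eventually (\<lambda>m. C / (q - \<sigma>) * \<rho> ^ m < \<alpha>) sequentially"
    using \<alpha>_pos by (intro order_tendstoD(2)) auto
  then obtain M0 where M0: "C / (q - \<sigma>) * \<rho> ^ M0 < \<alpha>" by (auto simp: eventually_sequentially)
  define K where "K = C * \<rho> ^ M0 / (q - \<sigma>)"
  have K: "0 \<le> K" "K < \<alpha>" using M0 C sigma rho by (auto simp: K_def)
  \<comment> \<open>The bound solves the recursion \<open>a (Suc n) = q * a n + C * \<rho> ^ M0 * \<sigma> ^ n\<close> with \<open>a 0 = - \<alpha>\<close>.\<close>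
  have main: "w (M0 + n * Q) (int (n * P)) \<le> - (q ^ n * \<alpha>) + K * (q ^ n - \<sigma> ^ n)
      \<and> w (M0 + n * Q) (int (n * P)) < 0" for n
  proof (induction n)
    case 0
    show ?case using left[of 0 M0] \<alpha>_pos by auto
  next
    case (Suc n)
    let ?m = "M0 + n * Q" and ?j = "int (n * P)"
    have err: "max 0 (w ?m (?j + int P)) \<le> C * \<rho> ^ M0 * \<sigma> ^ n"
    proof -
      have "max 0 (w ?m (?j + int P)) \<le> max 0 \<beta> * \<rho> ^ ?m * y powi (- (?j + int P))"
        unfolding \<rho>_def by (rule chernoff[OF y])
      also have "y powi (- (?j + int P)) = 1 / (y ^ P * (y ^ P) ^ n)"
      proof -
        have "- (?j + int P) = - int (P + n * P)" by simp
        hence "y powi (- (?j + int P)) = inverse (y ^ (P + n * P))"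
          by (simp only: power_int_minus power_int_of_nat)
        thus ?thesis by (simp add: power_add mult.commute[of n] power_mult inverse_eq_divide)
      qed
      also have "max 0 \<beta> * \<rho> ^ ?m * (1 / (y ^ P * (y ^ P) ^ n)) = C * \<rho> ^ M0 * \<sigma> ^ n"
        by (simp add: C_def \<sigma>_def power_add power_mult power_divide mult.commute[of n])
      finally show ?thesis .
    qed
    have "w (M0 + Suc n * Q) (int (Suc n * P)) = w (?m + Q) (?j + int P)"
      by (simp add: algebra_simps)
    also have "... \<le> q * w ?m ?j + max 0 (w ?m (?j + int P))"
      unfolding q_def using Suc by (intro block_bound) auto
    also have "... \<le> q * (- (q ^ n * \<alpha>) + K * (q ^ n - \<sigma> ^ n)) + C * \<rho> ^ M0 * \<sigma> ^ n"
      using Suc err sigma by (intro add_mono mult_left_mono) auto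
    also have "C * \<rho> ^ M0 = K * (q - \<sigma>)" using sigma by (simp add: K_def)
    also have "q * (- (q ^ n * \<alpha>) + K * (q ^ n - \<sigma> ^ n)) + K * (q - \<sigma>) * \<sigma> ^ n
        = - (q ^ Suc n * \<alpha>) + K * (q ^ Suc n - \<sigma> ^ Suc n)" by (simp add: algebra_simps)
    finally have *: "w (M0 + Suc n * Q) (int (Suc n * P)) \<le> - (q ^ Suc n * \<alpha>) + K * (q ^ Suc n - \<sigma> ^ Suc n)" .
    also have "... \<le> - (q ^ Suc n * \<alpha>) + K * q ^ Suc n"
      using K sigma by (intro add_left_mono mult_left_mono) auto
    also have "... = q ^ Suc n * (K - \<alpha>)" by (simp add: algebra_simps)
    also have "... < 0" using K sigma by (intro mult_pos_neg zero_less_power) auto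
    finally show ?case using * by blast
  qed
  have "eventually (\<lambda>m. u * real m \<le> (real m - real M0 - real Q) * (real P / real Q)) sequentially"
    using PQ(2) by real_asymp
  thus ?thesis using eventually_ge_at_top[of M0]
  proof eventually_elim
    case (elim m)
    define n where "n = (m - M0) div Q"
    have n1: "M0 + n * Q \<le> m" using elim(2) by (simp add: n_def) (metis add.commute div_times_less_eq_dividend le_diff_conv2)
    have "m - M0 < (n + 1) * Q" using PQ(1) by (simp add: n_def dividend_less_div_times)
    hence "m < M0 + n * Q + Q" using elim(2) by simp
    hence "real m < real (M0 + n * Q + Q)" by (rule less_imp_of_nat_less)
    hence "real m - real M0 - real Q < real n * real Q" by simp
    hence "(real m - real M0 - real Q) * (real P / real Q) \<le> real n * real Q * (real P / real Q)"
      by (intro mult_right_mono) auto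
    also have "... = real (n * P)" using PQ by simp
    finally have le: "u * real m \<le> real (n * P)" using elim(1) by linarith
    show ?case
    proof (intro allI impI)
      fix j assume "real_of_int j \<le> u * real m"
      hence "j \<le> int (n * P)" using le by linarith
      hence "w m j \<le> w m (int (n * P))" by (rule mono)
      also have "... \<le> w (M0 + n * Q) (int (n * P))" using n1 by (rule antimono_time)
      also have "... < 0" using main by blast
      finally show "w m j < 0" .
    qed
  qed
qed

end

section \<open>Rearrangement when one value is inserted\<close>

definition position_in :: "nat set \<Rightarrow> nat \<Rightarrow> nat" where
  "position_in S j = card (S \<inter> {..j})"

lemma position_less:
  assumes "finite S" "j \<in> S" "i < j"
  shows "position_in S i < position_in S j"
proof -
  have "S \<inter> {..i} \<subseteq> S \<inter> {..j}" "j \<in> S \<inter> {..j}" "j \<notin> S \<inter> {..i}" using assms by auto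
  hence "S \<inter> {..i} \<subset> S \<inter> {..j}" by blast
  thus ?thesis unfolding position_in_def using assms by (intro psubset_card_mono) auto
qed

lemma position_bij:
  assumes "finite S"
  shows "bij_betw (position_in S) S {1..card S}"
proof -
  have "inj_on (position_in S) S"
    by (rule inj_onI) (metis assms linorder_neqE_nat nat_neq_iff position_less)
  moreover have "position_in S ` S \<subseteq> {1..card S}"
    using assms by (auto simp: position_in_def Suc_le_eq card_gt_0_iff intro!: card_mono)
  ultimately show ?thesis
    by (simp add: bij_betw_def card_image card_subset_eq)
qed

lemma position_remove:
  assumes "finite S" "q \<in> S"
  shows "position_in (S - {q}) j = (if j < q then position_in S j else position_in S j - 1)"
proof (cases "j < q")
  case True
  hence "(S - {q}) \<inter> {..j} = S \<inter> {..j}" by auto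
  thus ?thesis using True by (simp add: position_in_def)
next
  case False
  hence "(S - {q}) \<inter> {..j} = (S \<inter> {..j}) - {q}" "q \<in> S \<inter> {..j}" using assms by auto
  thus ?thesis using False assms by (simp add: position_in_def card_Diff_singleton)
qed

lemma position_atLeastAtMost: "position_in {1..N} j = min j N"
proof -
  have "{1..N} \<inter> {..j} = {1..min j N}" by auto
  thus ?thesis by (simp add: position_in_def)
qed

abbreviation clamp_to where "clamp_to a b y \<equiv> max a (min y b)"

text \<open>A value \<open>y\<close> and the numbers \<open>c 1 \<le> \<dots> \<le> c n\<close> are to be matched with the \<open>n + 1\<close> rewards of the
  locations in \<open>S\<close>.  The entries \<open>c 0\<close> and \<open>c (n + 1)\<close> are sentinels that bound \<open>y\<close>.\<close>

locale assignment =
  fixes S :: "nat set" and c :: "int \<Rightarrow> real" and r :: "nat \<Rightarrow> real" and y :: real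
  assumes fin: "finite S" and r_mono: "strict_mono_on S r"
    and c_mono: "\<And>i j. i \<le> j \<Longrightarrow> c i \<le> c j"
    and c_low: "c 0 \<le> y" and c_high: "y \<le> c (int (card S))"
begin

text \<open>The entry at the position of \<open>j\<close> when \<open>y\<close> is merged into the sorted list of the \<open>c i\<close>.\<close>

definition sorted_value where
  "sorted_value j = clamp_to (c (int (position_in S j) - 1)) (c (int (position_in S j))) y"

text \<open>What location \<open>j\<close> receives when \<open>y\<close> is put into \<open>q\<close> and the \<open>c i\<close> fill the other locations in
  increasing order.\<close>

definition inserted_value where
  "inserted_value q j = (if j < q then c (int (position_in S j)) else if j = q then y else c (int (position_in S j) - 1))"

definition fits where
  "fits q \<longleftrightarrow> c (int (position_in S q) - 1) \<le> y \<and> y \<le> c (int (position_in S q))"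

lemma inserted_value_remove:
  assumes "q \<in> S" "j \<in> S - {q}"
  shows "inserted_value q j = c (int (position_in (S - {q}) j))"
proof -
  have "1 \<le> position_in S j" using position_bij[OF fin] assms by (auto dest!: bij_betwE)
  thus ?thesis using assms fin by (auto simp: inserted_value_def position_remove of_nat_diff)
qed

lemma sum_inserted:
  assumes "q \<in> S"
  shows "(\<Sum>j\<in>S. g j * inserted_value q j) = y * g q + (\<Sum>j\<in>S-{q}. g j * c (int (position_in (S - {q}) j)))"
proof -
  have "(\<Sum>j\<in>S. g j * inserted_value q j)
      = g q * inserted_value q q + (\<Sum>j\<in>S-{q}. g j * inserted_value q j)"
    using assms fin by (simp add: sum.remove)
  also have "(\<Sum>j\<in>S-{q}. g j * inserted_value q j) = (\<Sum>j\<in>S-{q}. g j * c (int (position_in (S - {q}) j)))"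
    using assms by (intro sum.cong) (auto simp: inserted_value_remove)
  finally show ?thesis by (simp add: inserted_value_def)
qed

lemma sum_c_position:
  assumes "finite T"
  shows "(\<Sum>j\<in>T. h (position_in T j)) = (\<Sum>i=1..card T. h i)"
  using sum.reindex_bij_betw[OF position_bij[OF assms], of h] .

text \<open>For \<open>a \<le> b\<close> the value of \<open>y\<close> clamped to \<open>[a, b]\<close> is \<open>a + min y b - min y a\<close>.\<close>

lemma sum_clamp_telescope:
  assumes "c 0 \<le> y"
  shows "(\<Sum>i=1..Suc n. clamp_to (c (int i - 1)) (c (int i)) y)
    = min y (c (int (Suc n))) + (\<Sum>i=1..n. c (int i))"
proof (induction n)
  case 0
  show ?case using assms c_mono[of 0 1] by (auto simp: max_def min_def)
next
  case (Suc n)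
  have "(\<Sum>i=1..Suc (Suc n). clamp_to (c (int i - 1)) (c (int i)) y)
     = min y (c (int (Suc n))) + (\<Sum>i=1..n. c (int i))
       + clamp_to (c (int (Suc n))) (c (int (Suc (Suc n)))) y"
    using Suc by simp
  also have "clamp_to (c (int (Suc n))) (c (int (Suc (Suc n)))) y
     = c (int (Suc n)) + min y (c (int (Suc (Suc n)))) - min y (c (int (Suc n)))"
    using c_mono[of "int (Suc n)" "int (Suc (Suc n))"] by (auto simp: max_def min_def)
  finally show ?case by simp
qed

lemma sum_sorted_eq_inserted:
  assumes "q \<in> S"
  shows "(\<Sum>j\<in>S. sorted_value j) = (\<Sum>j\<in>S. inserted_value q j)"
proof -
  obtain n where n: "card S = Suc n" using assms fin by (metis card_Suc_Diff1)
  have "(\<Sum>j\<in>S. sorted_value j) = (\<Sum>i=1..Suc n. clamp_to (c (int i - 1)) (c (int i)) y)"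
    using sum_c_position[OF fin, of "\<lambda>i. clamp_to (c (int i - 1)) (c (int i)) y"] n
    by (simp add: sorted_value_def)
  also have "... = y + (\<Sum>i=1..n. c (int i))"
    using sum_clamp_telescope[OF c_low, of n] c_high n by (simp add: min_def)
  also have "(\<Sum>i=1..n. c (int i)) = (\<Sum>j\<in>S-{q}. c (int (position_in (S - {q}) j)))"
    using sum_c_position[of "S - {q}" "\<lambda>i. c (int i)"] fin assms n by simp
  also have "y + ... = (\<Sum>j\<in>S. inserted_value q j)"
    using sum_inserted[OF assms, of "\<lambda>_. 1"] by simp
  finally show ?thesis .
qed

text \<open>Locations worth less than \<open>q\<close> receive at least their sorted share when \<open>y\<close> goes to \<open>q\<close>, and those
  worth more receive at most theirs.\<close>

lemma exchange_term_nonneg: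
  assumes "q \<in> S" "j \<in> S"
  shows "0 \<le> (r j - r q) * (sorted_value j - inserted_value q j)"
proof -
  have *: "c (int (position_in S j) - 1) \<le> c (int (position_in S j))" by (rule c_mono) simp
  consider "j < q" | "j = q" | "q < j" by linarith
  thus ?thesis
  proof cases
    case 1
    hence "r j < r q" using r_mono assms by (simp add: strict_mono_on_def)
    thus ?thesis using 1 * by (intro mult_nonpos_nonpos) (auto simp: sorted_value_def inserted_value_def)
  next
    case 3
    hence "r q < r j" using r_mono assms by (simp add: strict_mono_on_def)
    thus ?thesis using 3 * by (intro mult_nonneg_nonneg) (auto simp: sorted_value_def inserted_value_def)
  qed auto
qed

text \<open>Both ways of filling the locations distribute the same total, so \<open>r q\<close> may be subtracted from every
  reward; by \<open>exchange_term_nonneg\<close> all terms of the difference then have the same sign.\<close>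

lemma exchange_sum:
  assumes "q \<in> S"
  shows "(\<Sum>j\<in>S. r j * sorted_value j)
      - (y * r q + (\<Sum>j\<in>S-{q}. r j * c (int (position_in (S - {q}) j))))
    = (\<Sum>j\<in>S. (r j - r q) * (sorted_value j - inserted_value q j))"
proof -
  have "(\<Sum>j\<in>S. (r j - r q) * (sorted_value j - inserted_value q j))
     = (\<Sum>j\<in>S. r j * sorted_value j) - (\<Sum>j\<in>S. r j * inserted_value q j)
       - r q * ((\<Sum>j\<in>S. sorted_value j) - (\<Sum>j\<in>S. inserted_value q j))"
    by (simp add: algebra_simps sum.distrib sum_subtractf sum_distrib_left)
  thus ?thesis using sum_sorted_eq_inserted[OF assms] sum_inserted[OF assms, of r] by simp
qed

lemma insertion_le:
  assumes "q \<in> S"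
  shows "y * r q + (\<Sum>j\<in>S-{q}. r j * c (int (position_in (S - {q}) j))) \<le> (\<Sum>j\<in>S. r j * sorted_value j)"
  using exchange_sum[OF assms] sum_nonneg[of S "\<lambda>j. (r j - r q) * (sorted_value j - inserted_value q j)"]
    exchange_term_nonneg[OF assms] by simp

text \<open>A vanishing sum of nonnegative terms forces the two fillings to agree at every \<open>j \<noteq> q\<close>, where the
  rewards differ from \<open>r q\<close>, and by equality of the totals at \<open>q\<close> as well.\<close>

lemma insertion_eq_iff:
  assumes q: "q \<in> S"
  shows "y * r q + (\<Sum>j\<in>S-{q}. r j * c (int (position_in (S - {q}) j))) = (\<Sum>j\<in>S. r j * sorted_value j)
    \<longleftrightarrow> fits q" (is "?L = ?R \<longleftrightarrow> _")
proof
  assume "?L = ?R"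
  hence "(\<Sum>j\<in>S. (r j - r q) * (sorted_value j - inserted_value q j)) = 0"
    using exchange_sum[OF q] by simp
  hence zero: "(r j - r q) * (sorted_value j - inserted_value q j) = 0" if "j \<in> S" for j
    using sum_nonneg_eq_0_iff[OF fin exchange_term_nonneg[OF q]] that by simp
  have "sorted_value j = inserted_value q j" if "j \<in> S - {q}" for j
  proof -
    have "r j \<noteq> r q" using strict_mono_on_imp_inj_on[OF r_mono] that q by (auto dest: inj_onD)
    thus ?thesis using zero[of j] that by simp
  qed
  hence "(\<Sum>j\<in>S-{q}. sorted_value j) = (\<Sum>j\<in>S-{q}. inserted_value q j)" by (intro sum.cong) auto
  hence "sorted_value q = inserted_value q q"
    using sum_sorted_eq_inserted[OF q] q fin by (simp add: sum.remove)
  moreover have "c (int (position_in S q) - 1) \<le> c (int (position_in S q))" by (rule c_mono) simp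
  ultimately show "fits q"
    by (auto simp: fits_def sorted_value_def inserted_value_def max_def min_def split: if_splits)
next
  assume "fits q"
  have "sorted_value j = inserted_value q j" if j: "j \<in> S" for j
  proof -
    have le: "c (int (position_in S j) - 1) \<le> c (int (position_in S j))" by (rule c_mono) simp
    consider "j < q" | "j = q" | "q < j" by linarith
    thus ?thesis
    proof cases
      case 1
      have "c (int (position_in S j)) \<le> c (int (position_in S q) - 1)"
        using position_less[OF fin q 1] by (intro c_mono) simp
      thus ?thesis using 1 \<open>fits q\<close> le by (simp add: sorted_value_def inserted_value_def fits_def)
    next
      case 2
      thus ?thesis using \<open>fits q\<close> le by (simp add: sorted_value_def inserted_value_def fits_def)
    next
      case 3
      have "c (int (position_in S q)) \<le> c (int (position_in S j) - 1)"
        using position_less[OF fin j 3] by (intro c_mono) simp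
      thus ?thesis using 3 \<open>fits q\<close> le by (simp add: sorted_value_def inserted_value_def fits_def)
    qed
  qed
  hence "(\<Sum>j\<in>S. (r j - r q) * (sorted_value j - inserted_value q j)) = 0"
    by (intro sum.neutral) auto
  thus "?L = ?R" using exchange_sum[OF q] by simp
qed

text \<open>A measurable choice of a best location.  The disjunct on the maximum makes the choice well defined
  for arbitrary real \<open>y\<close>, hence also where a random value lies outside the support.\<close>

lemma least_fits:
  assumes "S \<noteq> {}"
  defines "q \<equiv> LEAST q. q \<in> S \<and> (y \<le> c (int (position_in S q)) \<or> (\<forall>s\<in>S. s \<le> q))"
  shows "q \<in> S" "fits q"
proof -
  have max: "Max S \<in> S" "\<forall>s\<in>S. s \<le> Max S" using fin assms by auto
  have q: "q \<in> S \<and> (y \<le> c (int (position_in S q)) \<or> (\<forall>s\<in>S. s \<le> q))"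
    unfolding q_def by (rule LeastI[of _ "Max S"]) (use max in auto)
  show "q \<in> S" using q by simp
  have "y \<le> c (int (position_in S q))"
  proof (cases "\<forall>s\<in>S. s \<le> q")
    case True
    hence "S \<inter> {..q} = S" by auto
    thus ?thesis using c_high by (simp add: position_in_def)
  qed (use q in auto)
  moreover have "c (int (position_in S q) - 1) \<le> y"
  proof (cases "position_in S q = 1")
    case True thus ?thesis using c_low by simp
  next
    case False
    have "position_in S q \<in> {1..card S}" using position_bij[OF fin] q by (auto dest: bij_betwE)
    hence "position_in S q - 1 \<in> {1..card S}" using False by auto
    then obtain s where s: "s \<in> S" "position_in S s = position_in S q - 1"
      using position_bij[OF fin] by (metis bij_betw_imp_surj_on imageE)
    have "s < q"
      using s \<open>position_in S q \<in> {1..card S}\<close> position_less[OF fin s(1), of q] by (metis atLeastAtMost_iff diff_less less_one linorder_neqE_nat not_less order_less_imp_le less_le_trans zero_less_one order_refl less_irrefl)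
    hence "\<not> y \<le> c (int (position_in S s))"
      using not_less_Least[of s "\<lambda>q. q \<in> S \<and> (y \<le> c (int (position_in S q)) \<or> (\<forall>s\<in>S. s \<le> q))"] s
      by (auto simp flip: q_def)
    thus ?thesis using s \<open>position_in S q \<in> {1..card S}\<close> by (simp add: of_nat_diff)
  qed
  ultimately show "fits q" by (simp add: fits_def)
qed

end

section \<open>Thresholds and where they cross a level\<close>

locale finite_distribution =
  fixes k :: nat and x p :: "nat \<Rightarrow> real"
  assumes k3: "3 \<le> k" and x_mono: "strict_mono_on {1..k} x"
    and p_pos: "\<And>i. i \<in> {1..k} \<Longrightarrow> 0 < p i" and p_sum: "(\<Sum>i = 1..k. p i) = 1"
begin

text \<open>\<open>thr m j\<close> is the optimal expected value for the \<open>j\<close>-th smallest of \<open>m\<close> locations.  Positions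
  \<open>j \<le> 0\<close> and \<open>j > m\<close> carry the extreme values \<open>x 1\<close> and \<open>x k\<close>, which do not constrain any value of
  the distribution; indices are integers so that the recursion and the reflection of positions have
  no boundary cases.\<close>

fun thr :: "nat \<Rightarrow> int \<Rightarrow> real" where
  "thr 0 j = (if j \<le> 0 then x 1 else x k)"
| "thr (Suc m) j = (\<Sum>i=1..k. p i * clamp_to (thr m (j - 1)) (thr m j) (x i))"

lemma x_less: "i \<in> {1..k} \<Longrightarrow> j \<in> {1..k} \<Longrightarrow> i < j \<Longrightarrow> x i < x j"
  using x_mono by (simp add: strict_mono_on_def)

lemma x_le: "i \<in> {1..k} \<Longrightarrow> j \<in> {1..k} \<Longrightarrow> i \<le> j \<Longrightarrow> x i \<le> x j"
  using x_less[of i j] by (cases "i = j") auto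

lemma x_eq_iff: "i \<in> {1..k} \<Longrightarrow> j \<in> {1..k} \<Longrightarrow> x i = x j \<longleftrightarrow> i = j"
  using strict_mono_on_imp_inj_on[OF x_mono] by (rule inj_on_eq_iff)

lemma mix_mono:
  assumes "\<And>i. i \<in> {1..k} \<Longrightarrow> g i \<le> h i"
  shows "(\<Sum>i=1..k. p i * g i) \<le> (\<Sum>i=1..k. p i * h i)"
  using assms p_pos by (intro sum_mono mult_left_mono) (auto simp: less_imp_le)

lemma mix_less:
  assumes "\<And>i. i \<in> {1..k} \<Longrightarrow> g i \<le> h i" "i0 \<in> {1..k}" "g i0 < h i0"
  shows "(\<Sum>i=1..k. p i * g i) < (\<Sum>i=1..k. p i * h i)"
  using assms p_pos
  by (intro sum_strict_mono_ex1) (auto intro!: mult_left_mono bexI[of _ i0] simp: less_imp_le)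

lemma mix_const: "(\<Sum>i=1..k. p i * c) = c"
  using p_sum by (simp flip: sum_distrib_right)

lemma thr_step: "thr m j \<le> thr m (j + 1)"
proof (induction m arbitrary: j)
  case 0
  show ?case using x_le[of 1 k] k3 by auto
next
  case (Suc m)
  have "thr m (j - 1) \<le> thr m j" "thr m j \<le> thr m (j + 1)" using Suc[of "j - 1"] Suc[of j] by auto
  thus ?case unfolding thr.simps by (intro mix_mono) auto
qed

lemma thr_mono: "i \<le> j \<Longrightarrow> thr m i \<le> thr m j"
  by (induction rule: int_ge_induct) (auto intro: order_trans[OF _ thr_step])

lemma thr_low: "j \<le> 0 \<Longrightarrow> thr m j = x 1"
proof (induction m arbitrary: j)
  case (Suc m)
  have "(\<Sum>i=1..k. p i * clamp_to (thr m (j - 1)) (thr m j) (x i)) = (\<Sum>i=1..k. p i * x 1)"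
    using Suc.IH[of j] Suc.IH[of "j - 1"] Suc.prems x_le[of 1] k3 by (intro sum.cong) auto
  thus ?case by (simp only: thr.simps mix_const)
qed auto

lemma thr_high: "int m < j \<Longrightarrow> thr m j = x k"
proof (induction m arbitrary: j)
  case (Suc m)
  have "(\<Sum>i=1..k. p i * clamp_to (thr m (j - 1)) (thr m j) (x i)) = (\<Sum>i=1..k. p i * x k)"
    using Suc.IH[of j] Suc.IH[of "j - 1"] Suc.prems x_le[of _ k] k3 by (intro sum.cong) auto
  thus ?case by (simp only: thr.simps mix_const)
qed auto

lemma thr_bounds: "x 1 \<le> thr m j" "thr m j \<le> x k"
  using thr_mono[of "min j 0" j m] thr_low[of "min j 0" m]
    thr_mono[of j "max j (int m + 1)" m] thr_high[of m "max j (int m + 1)"] by auto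

lemma thr_gt_low: "1 \<le> j \<Longrightarrow> x 1 < thr m j"
proof (induction m arbitrary: j)
  case 0
  thus ?case using x_less[of 1 k] k3 by simp
next
  case (Suc m)
  have "(\<Sum>i=1..k. p i * x 1) < (\<Sum>i=1..k. p i * clamp_to (thr m (j - 1)) (thr m j) (x i))"
    by (rule mix_less[of _ _ k])
       (use k3 x_less[of 1 k] Suc.IH[of j] Suc.prems thr_bounds in \<open>auto simp: less_max_iff_disj le_max_iff_disj\<close>)
  thus ?case by (simp only: thr.simps mix_const)
qed

lemma thr_less_high: "j \<le> int m \<Longrightarrow> thr m j < x k"
proof (induction m arbitrary: j)
  case 0
  thus ?case using x_less[of 1 k] k3 by simp
next
  case (Suc m)
  have "thr m (j - 1) < x k" using Suc.IH[of "j - 1"] Suc.prems by auto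
  hence "(\<Sum>i=1..k. p i * clamp_to (thr m (j - 1)) (thr m j) (x i)) < (\<Sum>i=1..k. p i * x k)"
    by (intro mix_less[of _ _ 1])
       (use k3 x_less[of 1 k] thr_bounds x_le[of _ k] in \<open>auto simp: min_le_iff_disj min_less_iff_disj\<close>)
  thus ?case by (simp only: thr.simps mix_const)
qed

lemma mix_two:
  assumes "n \<le> k"
  shows "(\<Sum>i=1..k. p i * (if i \<le> n then a else b)) = cum_prob p n * a + (1 - cum_prob p n) * b"
proof -
  have "(\<Sum>i=1..k. p i * (if i \<le> n then a else b))
      = (\<Sum>i\<in>{1..n}. p i * a) + (\<Sum>i\<in>{n+1..k}. p i * b)"
  proof -
    have "{1..k} = {1..n} \<union> {n+1..k}" using assms by auto
    thus ?thesis by (simp add: sum.union_disjoint)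
  qed
  moreover have "(\<Sum>i\<in>{n+1..k}. p i) = 1 - cum_prob p n"
    using sum.ub_add_nat[of 1 n p "k - n"] assms p_sum by (simp add: cum_prob_def)
  ultimately show ?thesis by (simp add: cum_prob_def flip: sum_distrib_right)
qed

text \<open>Truncated from below at \<open>x n\<close>, the recursion is dominated by that of a walk: values up to \<open>x n\<close>,
  which have probability \<open>cum_prob p n\<close>, contribute at most the left neighbour, and all others at most
  the right one.  Used both at the level \<open>x i\<close> and at the level below.\<close>

lemma thr_max_le:
  assumes "n \<in> {1..k}"
  shows "max (thr (Suc m) j) (x n)
    \<le> cum_prob p n * max (thr m (j - 1)) (x n) + (1 - cum_prob p n) * max (thr m j) (x n)"
proof -
  let ?g = "\<lambda>i. if i \<le> n then max (thr m (j - 1)) (x n) else max (thr m j) (x n)"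
  have 0: "thr m (j - 1) \<le> thr m j" by (rule thr_mono) simp
  have "thr (Suc m) j \<le> (\<Sum>i=1..k. p i * ?g i)"
    unfolding thr.simps
  proof (rule mix_mono)
    fix i assume "i \<in> {1..k}"
    thus "clamp_to (thr m (j - 1)) (thr m j) (x i) \<le> ?g i" using x_le[of i n] assms 0 by auto
  qed
  moreover have "(\<Sum>i=1..k. p i * x n) \<le> (\<Sum>i=1..k. p i * ?g i)" by (intro mix_mono) auto
  ultimately show ?thesis using assms by (simp only: mix_two mix_const atLeastAtMost_iff max.bounded_iff)
qed

lemma thr_min_ge:
  assumes "n \<in> {1..k}"
  shows "cum_prob p (n - 1) * min (thr m (j - 1)) (x n) + (1 - cum_prob p (n - 1)) * min (thr m j) (x n)
    \<le> min (thr (Suc m) j) (x n)"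
proof -
  let ?g = "\<lambda>i. if i \<le> n - 1 then min (thr m (j - 1)) (x n) else min (thr m j) (x n)"
  have 0: "thr m (j - 1) \<le> thr m j" by (rule thr_mono) simp
  have "(\<Sum>i=1..k. p i * ?g i) \<le> thr (Suc m) j"
    unfolding thr.simps
  proof (rule mix_mono)
    fix i assume "i \<in> {1..k}"
    thus "?g i \<le> clamp_to (thr m (j - 1)) (thr m j) (x i)"
      using x_le[of n i] assms 0 by (cases "n \<le> i") auto
  qed
  moreover have "(\<Sum>i=1..k. p i * ?g i) \<le> (\<Sum>i=1..k. p i * x n)" by (intro mix_mono) auto
  moreover have "n - 1 \<le> k" using assms by auto
  ultimately show ?thesis by (simp only: mix_two mix_const) simp
qed

lemma cum_prob_bounds:
  assumes "i \<in> {2..k-1}"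
  shows "0 < cum_prob p (i - 1)" "cum_prob p (i - 1) < cum_prob p i" "cum_prob p i < 1"
proof -
  show "0 < cum_prob p (i - 1)" unfolding cum_prob_def using assms p_pos by (intro sum_pos) auto
  have ik: "i \<in> {1..k}" using assms by auto
  obtain i' where i': "i = Suc i'" using assms by (cases i) auto
  show "cum_prob p (i - 1) < cum_prob p i" using p_pos[of i] ik i' by (simp add: cum_prob_def)
  have "cum_prob p i < sum p {1..k}" unfolding cum_prob_def
    using assms p_pos by (intro sum_strict_mono2[of _ _ k]) (auto simp: less_imp_le)
  thus "cum_prob p i < 1" using p_sum by simp
qed

text \<open>Truncating at \<open>x (i - 1)\<close> makes the thresholds a subsolution for \<open>cum_prob p (i - 1)\<close>, and truncating
  at \<open>x i\<close> makes them one for \<open>cum_prob p i\<close>; the two inequalities are the two speeds.\<close>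

lemma thr_below:
  assumes i: "i \<in> {2..k-1}" and u: "u < limit_location k p i"
  shows "eventually (\<lambda>m. \<forall>j. real_of_int j \<le> u * real m \<longrightarrow> thr m j < x i) sequentially"
proof -
  note cp = cum_prob_bounds[OF i]
  have ik: "i \<in> {1..k}" "i - 1 \<in> {1..k}" "i - 1 < i" using i by auto
  have xi: "x (i - 1) < x i" "x 1 \<le> x (i - 1)" using x_less x_le ik by auto
  define w where "w m j = max (thr m j) (x (i - 1)) - x i" for m j
  interpret two_speed w "cum_prob p (i - 1)" "cum_prob p i" "x i - x (i - 1)" "x k - x i"
  proof
    show "w a b \<le> w a c" if "b \<le> c" for a b c
      using thr_mono[OF that, of a] by (auto simp: w_def)
    show "w m j \<le> - (x i - x (i - 1))" if "j \<le> 0" for m j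
      using thr_low[OF that, of m] xi by (simp add: w_def)
    show "w 0 j \<le> x k - x i" for j using thr_bounds(2)[of 0 j] x_le[of "i-1" k] ik by (simp add: w_def)
    show "w (Suc m) j \<le> cum_prob p (i - 1) * w m (j - 1) + (1 - cum_prob p (i - 1)) * w m j" for m j
      using thr_max_le[OF ik(2), of m j] unfolding w_def by (simp only: algebra_simps)
    have w_pos: "max 0 (w m j) = max (thr m j) (x i) - x i" for m j using xi by (auto simp: w_def)
    show "max 0 (w (Suc m) j) \<le> cum_prob p i * max 0 (w m (j - 1)) + (1 - cum_prob p i) * max 0 (w m j)" for m j
      using thr_max_le[OF ik(1), of m j] unfolding w_pos by (simp only: algebra_simps)
  qed (use cp xi in auto)
  have "limit_location k p i = balance (cum_prob p (i - 1)) (cum_prob p i)"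
    using i by (auto simp: limit_location_def balance_def)
  hence "eventually (\<lambda>m. \<forall>j. real_of_int j \<le> u * real m \<longrightarrow> w m j < 0) sequentially"
    using u by (intro negative_below_balance) simp
  thus ?thesis by eventually_elim (auto simp: w_def)
qed

text \<open>The mirror image of \<open>thr_below\<close>: replacing values by their negatives and \<open>j\<close> by \<open>m + 1 - j\<close>
  exchanges left and right neighbours, hence every probability with its complement.\<close>

lemma thr_above:
  assumes i: "i \<in> {2..k-1}" and u: "limit_location k p i < u"
  shows "eventually (\<lambda>m. \<forall>j. u * real m + 1 \<le> real_of_int j \<longrightarrow> x i < thr m j) sequentially"
proof -
  note cp = cum_prob_bounds[OF i]
  have ik: "i \<in> {1..k}" "i + 1 \<in> {1..k}" using i by auto
  have xi: "x i < x (i + 1)" "x (i + 1) \<le> x k" using x_less x_le ik by auto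
  define w where "w m j = x i - min (thr m (int m + 1 - j)) (x (i + 1))" for m j
  interpret two_speed w "1 - cum_prob p i" "1 - cum_prob p (i - 1)" "x (i + 1) - x i" "x i - x 1"
  proof
    show "w a b \<le> w a c" if "b \<le> c" for a b c
      using thr_mono[of "int a + 1 - c" "int a + 1 - b" a] that by (auto simp: w_def)
    show "w m j \<le> - (x (i + 1) - x i)" if "j \<le> 0" for m j
      using thr_high[of m "int m + 1 - j"] xi that by (simp add: w_def)
    show "w 0 j \<le> x i - x 1" for j using thr_bounds(1)[of 0 "int 0 + 1 - j"] x_le[of 1 "i+1"] ik by (auto simp: w_def)
    have shift: "int (Suc m) + 1 - j = int m + 2 - j" "int m + 2 - j - 1 = int m + 1 - j"
      "int m + 1 - (j - 1) = int m + 2 - j" for m j by auto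
    show "w (Suc m) j \<le> (1 - cum_prob p i) * w m (j - 1) + (1 - (1 - cum_prob p i)) * w m j" for m j
      using thr_min_ge[OF ik(2), of m "int m + 2 - j"] unfolding w_def shift
      by (simp only: algebra_simps add_diff_cancel_right' add_0_right) simp
    have w_pos: "max 0 (w m j) = x i - min (thr m (int m + 1 - j)) (x i)" for m j using xi by (auto simp: w_def)
    show "max 0 (w (Suc m) j) \<le> (1 - cum_prob p (i - 1)) * max 0 (w m (j - 1))
        + (1 - (1 - cum_prob p (i - 1))) * max 0 (w m j)" for m j
      using thr_min_ge[OF ik(1), of m "int m + 2 - j"] unfolding w_pos shift
      by (simp only: algebra_simps)
  qed (use cp xi in auto)
  have "limit_location k p i = balance (cum_prob p (i - 1)) (cum_prob p i)"
    using i by (auto simp: limit_location_def balance_def)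
  hence "eventually (\<lambda>m. \<forall>j. real_of_int j \<le> (1 - u) * real m \<longrightarrow> w m j < 0) sequentially"
    using u balance_reflect[OF cp] by (intro negative_below_balance) simp
  thus ?thesis
  proof eventually_elim
    case (elim m)
    show ?case
    proof (intro allI impI)
      fix j assume "u * real m + 1 \<le> real_of_int j"
      hence "real_of_int (int m + 1 - j) \<le> (1 - u) * real m" by (simp add: algebra_simps)
      hence "w m (int m + 1 - j) < 0" using elim by blast
      thus "x i < thr m j" by (auto simp: w_def)
    qed
  qed
qed

text \<open>The extreme levels are exact, not only asymptotic: \<open>thr m\<close> exceeds \<open>x 1\<close> from position \<open>1\<close> on and is
  below \<open>x k\<close> up to position \<open>m\<close>.\<close>

lemma location_limit:
  assumes i: "i \<in> {1..k}"
    and loc: "\<And>m. thr m (int (L m) - 1) \<le> x i \<and> x i \<le> thr m (int (L m)) \<and> 1 \<le> L m \<and> L m \<le> Suc m"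
  shows "(\<lambda>m. real (L m) / real (Suc m)) \<longlonglongrightarrow> limit_location k p i"
proof -
  consider "i = 1" | "i = k" | "i \<in> {2..k-1}" using i by fastforce
  thus ?thesis
  proof cases
    case 1
    have "L m = 1" for m
      using thr_gt_low[of "int (L m) - 1" m] loc[of m] 1 by force
    thus ?thesis using 1 by (simp add: limit_location_def) real_asymp
  next
    case 2
    have "L m = Suc m" for m
      using thr_less_high[of "int (L m)" m] loc[of m] 2 by force
    thus ?thesis using 2 k3 by (simp add: limit_location_def)
  next
    case 3
    let ?d = "limit_location k p i"
    show ?thesis
    proof (rule order_tendstoI)
      fix a assume "a < ?d"
      then obtain u where u: "a < u" "u < ?d" using dense by blast
      have "eventually (\<lambda>m. a * real (Suc m) < u * real m) sequentially" using u(1) by real_asymp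
      with thr_below[OF 3 u(2)] show "eventually (\<lambda>m. a < real (L m) / real (Suc m)) sequentially"
      proof eventually_elim
        case (elim m)
        have "\<not> real_of_int (int (L m)) \<le> u * real m" using elim(1) loc[of m] by fastforce
        hence "a * real (Suc m) < real (L m)" using elim(2) by simp
        thus ?case by (simp add: field_simps)
      qed
    next
      fix a assume "?d < a"
      then obtain u where u: "?d < u" "u < a" using dense by blast
      have "eventually (\<lambda>m. u * real m + 2 < a * real (Suc m)) sequentially" using u(2) by real_asymp
      with thr_above[OF 3 u(1)] show "eventually (\<lambda>m. real (L m) / real (Suc m) < a) sequentially"
      proof eventually_elim
        case (elim m)
        have "\<not> u * real m + 1 \<le> real_of_int (int (L m) - 1)" using elim(1) loc[of m] by fastforce
        hence "real (L m) < a * real (Suc m)" using elim(2) by simp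
        thus ?case by (simp add: field_simps)
      qed
    qed
  qed
qed

end

section \<open>Histories and policies\<close>

lemma space_history [simp]: "space (history M X t) = space M"
  by (auto simp: history_def space_measure_of_conv)

lemma sets_history:
  "sets (history M X t) = sigma_sets (space M) (\<Union>s\<in>{1..t}. {X s -` A \<inter> space M | A. A \<in> sets borel})"
  unfolding history_def by (rule sets_measure_of) auto

lemma sets_history_mono:
  assumes "s \<le> t"
  shows "sets (history M X s) \<subseteq> sets (history M X t)"
  unfolding sets_history
proof (rule sigma_sets_mono', rule subsetI)
  let ?G = "\<lambda>u. {X u -` A \<inter> space M | A. A \<in> sets borel}"
  fix B assume "B \<in> (\<Union>u\<in>{1..s}. ?G u)"
  then obtain u where "u \<in> {1..s}" "B \<in> ?G u" by (rule UN_E)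
  thus "B \<in> (\<Union>u\<in>{1..t}. ?G u)" using assms by (intro UN_I[of u]) simp_all
qed

lemma measurable_history_mono:
  assumes "f \<in> history M X s \<rightarrow>\<^sub>M L" "s \<le> t"
  shows "f \<in> history M X t \<rightarrow>\<^sub>M L"
  using assms measurable_mono[of L L "history M X s" "history M X t"] sets_history_mono[of s t M X]
  by auto

lemma measurable_history:
  assumes "s \<in> {1..t}"
  shows "X s \<in> borel_measurable (history M X t)"
proof (rule measurableI)
  fix A :: "real set" assume "A \<in> sets borel"
  thus "X s -` A \<inter> space (history M X t) \<in> sets (history M X t)"
    unfolding sets_history space_history by (intro sigma_sets.Basic UN_I[OF assms]) blast
qed simp

definition remaining :: "nat \<Rightarrow> (nat \<Rightarrow> 'a \<Rightarrow> nat) \<Rightarrow> nat \<Rightarrow> 'a \<Rightarrow> nat set" where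
  "remaining N J t \<omega> = {1..N} - (\<lambda>s. J s \<omega>) ` {1..t}"

lemma remaining_0 [simp]: "remaining N J 0 \<omega> = {1..N}"
  by (simp add: remaining_def)

lemma remaining_Suc: "remaining N J (Suc t) \<omega> = remaining N J t \<omega> - {J (Suc t) \<omega>}"
  by (auto simp: remaining_def atLeastAtMostSuc_conv)

text \<open>One round of a policy: the choice may depend on the set of empty locations, which takes finitely many
  values.\<close>

lemma measurable_remove_chosen:
  assumes "R \<in> L \<rightarrow>\<^sub>M count_space (Pow {1..N})"
    and "\<And>S. S \<in> Pow {1..N} \<Longrightarrow> g S \<in> L \<rightarrow>\<^sub>M count_space UNIV"
  shows "(\<lambda>\<omega>. R \<omega> - {g (R \<omega>) \<omega>}) \<in> L \<rightarrow>\<^sub>M count_space (Pow {1..N::nat})"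
proof (rule measurable_compose_countable'[OF _ assms(1)])
  fix S assume "S \<in> Pow {1..N}"
  thus "(\<lambda>\<omega>. S - {g S \<omega>}) \<in> L \<rightarrow>\<^sub>M count_space (Pow {1..N})"
    by (intro measurable_compose[OF assms(2), of S "\<lambda>q. S - {q}"]) auto
qed (auto intro: countable_finite)

context
  fixes M :: "'a measure" and N :: nat and X :: "nat \<Rightarrow> 'a \<Rightarrow> real" and J :: "nat \<Rightarrow> 'a \<Rightarrow> nat"
  assumes J: "policy M N X J"
begin

lemma policy_measurable:
  assumes "t \<in> {1..N}"
  shows "J t \<in> history M X t \<rightarrow>\<^sub>M count_space UNIV"
  using measurable_compose[of "J t" "history M X t" "count_space {1..N}" "\<lambda>q. q" "count_space UNIV"] J assms
  by (simp add: policy_def)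

lemma remaining_measurable:
  assumes "t \<le> N"
  shows "remaining N J t \<in> history M X t \<rightarrow>\<^sub>M count_space (Pow {1..N})"
  using assms
proof (induction t)
  case 0
  have "(\<lambda>\<omega>. {1..N}) \<in> history M X 0 \<rightarrow>\<^sub>M count_space (Pow {1..N})" by simp
  thus ?case by (subst measurable_cong[where g = "\<lambda>_. {1..N}"]) auto
next
  case (Suc t)
  have "(\<lambda>\<omega>. remaining N J t \<omega> - {J (Suc t) \<omega>}) \<in> history M X (Suc t) \<rightarrow>\<^sub>M count_space (Pow {1..N})"
  proof (rule measurable_remove_chosen[where g = "\<lambda>_. J (Suc t)"])
    show "remaining N J t \<in> history M X (Suc t) \<rightarrow>\<^sub>M count_space (Pow {1..N})"
      by (rule measurable_history_mono[of "remaining N J t" M X t]) (use Suc in simp_all)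
  qed (use Suc.prems policy_measurable in simp)
  thus ?case by (subst measurable_cong[OF remaining_Suc])
qed

lemma policy_in_remaining:
  assumes "\<omega> \<in> space M" "t \<in> {1..N}"
  shows "J t \<omega> \<in> remaining N J (t - 1) \<omega>"
proof -
  have "J t \<omega> \<in> {1..N}"
    using J assms by (auto simp: policy_def dest!: bspec[where x = t] measurable_space)
  moreover have "J t \<omega> \<notin> (\<lambda>s. J s \<omega>) ` {1..t - 1}"
  proof
    assume "J t \<omega> \<in> (\<lambda>s. J s \<omega>) ` {1..t - 1}"
    then obtain s where "s \<in> {1..t - 1}" "J s \<omega> = J t \<omega>" by force
    moreover have "inj_on (\<lambda>t. J t \<omega>) {1..N}" using J assms by (simp add: policy_def)
    ultimately have "s = t" using assms by (auto dest!: inj_onD)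
    thus False using \<open>s \<in> {1..t - 1}\<close> assms by auto
  qed
  ultimately show ?thesis by (simp add: remaining_def)
qed

lemma remaining_final:
  assumes "\<omega> \<in> space M"
  shows "remaining N J N \<omega> = {}"
proof -
  have "inj_on (\<lambda>t. J t \<omega>) {1..N}" using J assms by (simp add: policy_def)
  moreover have "(\<lambda>t. J t \<omega>) ` {1..N} \<subseteq> {1..N}"
    using policy_in_remaining[OF assms] by (force simp: remaining_def)
  ultimately have "(\<lambda>t. J t \<omega>) ` {1..N} = {1..N}" by (simp add: endo_inj_surj)
  thus ?thesis by (simp add: remaining_def)
qed

end

section \<open>Optimal policies and thresholds\<close>

locale sequential_assignment = finite_distribution k x p + prob_space M
  for k :: nat and x p :: "nat \<Rightarrow> real" and M :: "'a measure" +
  fixes N :: nat and X :: "nat \<Rightarrow> 'a \<Rightarrow> real" and r :: "nat \<Rightarrow> real"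
  assumes iid: "iid_with_pmf M N k x p X" and r_mono: "strict_mono_on {1..N} r"
begin

lemma indep: "indep_vars (\<lambda>_. borel) X {1..N}"
  and X_prob: "t \<in> {1..N} \<Longrightarrow> i \<in> {1..k} \<Longrightarrow> prob {\<omega> \<in> space M. X t \<omega> = x i} = p i"
  using iid by (auto simp: iid_with_pmf_def)

lemma X_measurable [measurable]: "t \<in> {1..N} \<Longrightarrow> X t \<in> borel_measurable M"
  using indep by (simp add: indep_vars_def2)

lemma history_subset: "t \<le> N \<Longrightarrow> sets (history M X t) \<subseteq> events"
  unfolding sets_history by (rule sets.sigma_sets_subset) (auto intro!: measurable_sets[of _ M borel])

lemma measurable_from_history:
  assumes "f \<in> history M X t \<rightarrow>\<^sub>M L" "t \<le> N"
  shows "f \<in> M \<rightarrow>\<^sub>M L"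
  using assms measurable_mono[of L L "history M X t" M] history_subset[of t] by auto

lemma AE_X_in_values:
  assumes t: "t \<in> {1..N}"
  shows "AE \<omega> in M. X t \<omega> \<in> x ` {1..k}"
proof -
  note [measurable] = X_measurable[OF t]
  let ?A = "\<lambda>i. {\<omega> \<in> space M. X t \<omega> = x i}"
  have "prob (\<Union>i\<in>{1..k}. ?A i) = (\<Sum>i\<in>{1..k}. prob (?A i))"
  proof (rule finite_measure_finite_Union)
    show "disjoint_family_on ?A {1..k}"
      by (auto simp: disjoint_family_on_def x_eq_iff)
  qed auto
  also have "... = 1" using X_prob[OF t] p_sum by simp
  finally have "AE \<omega> in M. \<omega> \<in> (\<Union>i\<in>{1..k}. ?A i)" by (rule AE_prob_1)
  thus ?thesis by eventually_elim auto
qed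

text \<open>Events of the first \<open>t - 1\<close> rounds and the value of round \<open>t\<close> come from disjoint blocks of the
  independent family.\<close>

lemma history_indep:
  assumes t: "t \<in> {1..N}" and i: "i \<in> {1..k}" and A: "A \<in> sets (history M X (t - 1))"
  shows "prob (A \<inter> {\<omega> \<in> space M. X t \<omega> = x i}) = prob A * p i"
proof -
  let ?E = "\<lambda>s. {X s -` B \<inter> space M | B. B \<in> sets borel}"
  let ?I = "\<lambda>b. if b then {1..t - 1} else {t}"
  have "indep_sets (\<lambda>b. sigma_sets (space M) (\<Union>s\<in>?I b. ?E s)) (UNIV :: bool set)"
  proof (rule indep_sets_collect_sigma)
    show "indep_sets ?E (\<Union>b\<in>UNIV. ?I b)"
      by (rule indep_sets_mono_index[of _ "{1..N}"])
        (use indep t in \<open>auto simp: indep_vars_def2 split: if_splits\<close>)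
    show "disjoint_family_on ?I UNIV" using t by (auto simp: disjoint_family_on_def)
    show "Int_stable (?E s)" for s
    proof (rule Int_stableI)
      fix a b assume "a \<in> ?E s" "b \<in> ?E s"
      then obtain A B where "A \<in> sets borel" "B \<in> sets borel"
        "a = X s -` A \<inter> space M" "b = X s -` B \<inter> space M" by blast
      hence "A \<inter> B \<in> sets borel" "a \<inter> b = X s -` (A \<inter> B) \<inter> space M" by auto
      thus "a \<inter> b \<in> ?E s" by blast
    qed
  qed
  moreover have "{\<omega> \<in> space M. X t \<omega> = x i} = X t -` {x i} \<inter> space M" by auto
  hence "{\<omega> \<in> space M. X t \<omega> = x i} \<in> sigma_sets (space M) (\<Union>s\<in>{t}. ?E s)"
    by (auto intro!: sigma_sets.Basic)
  ultimately have "prob (\<Inter>b\<in>UNIV. if b then A else {\<omega> \<in> space M. X t \<omega> = x i})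
      = (\<Prod>b\<in>UNIV. prob (if b then A else {\<omega> \<in> space M. X t \<omega> = x i}))"
    using A by (intro indep_setsD) (auto simp: sets_history)
  thus ?thesis using X_prob[OF t i] by (simp add: UNIV_bool Int_commute mult.commute)
qed

text \<open>Freezing: \<open>Y\<close> is determined by the past and takes finitely many values, so the fresh value \<open>X t\<close> can
  be averaged separately for each value of \<open>Y\<close>.\<close>

lemma expectation_mix:
  fixes Y :: "'a \<Rightarrow> 'b" and h :: "'b \<Rightarrow> real \<Rightarrow> real"
  assumes t: "t \<in> {1..N}" and Y: "Y \<in> history M X (t - 1) \<rightarrow>\<^sub>M count_space A" and A: "finite A"
    and h: "\<And>a. h a \<in> borel_measurable borel"
  shows "expectation (\<lambda>\<omega>. h (Y \<omega>) (X t \<omega>)) = (\<Sum>a\<in>A. prob (Y -` {a} \<inter> space M) * (\<Sum>i=1..k. p i * h a (x i)))"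
proof -
  note [measurable] = X_measurable[OF t]
  let ?E = "\<lambda>a i. (Y -` {a} \<inter> space M) \<inter> {\<omega> \<in> space M. X t \<omega> = x i}"
  let ?f = "\<lambda>\<omega>. h (Y \<omega>) (X t \<omega>)" and ?g = "\<lambda>\<omega>. \<Sum>a\<in>A. \<Sum>i=1..k. h a (x i) * indicator (?E a i) \<omega>"
  have YM: "Y \<in> M \<rightarrow>\<^sub>M count_space A" using measurable_from_history[OF Y] t by auto
  have Ya: "Y -` {a} \<inter> space M \<in> sets (history M X (t - 1))" if "a \<in> A" for a
    using measurable_sets[OF Y, of "{a}"] that by simp
  hence Ya': "Y -` {a} \<inter> space M \<in> events" if "a \<in> A" for a proof -
    have "t - 1 \<le> N" using t by auto
    thus ?thesis using history_subset[of "t - 1"] Ya[OF that] by blast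
  qed
  have E: "?E a i \<in> events" if "a \<in> A" for a i using sets.Int[OF Ya'[OF that], of "{\<omega> \<in> space M. X t \<omega> = x i}"] by measurable
  have f: "?f \<in> borel_measurable M"
    by (rule measurable_compose_countable'[OF _ YM]) (use h A in \<open>auto intro: countable_finite measurable_compose\<close>)
  have "has_bochner_integral M (\<lambda>\<omega>. h a (x i) * indicator (?E a i) \<omega>) (h a (x i) * prob (?E a i))"
    if "a \<in> A" for a i
    using E[OF that] by (intro has_bochner_integral_mult_right has_bochner_integral_real_indicator)
      (simp_all add: less_top[symmetric])
  hence hbi: "has_bochner_integral M ?g (\<Sum>a\<in>A. \<Sum>i=1..k. h a (x i) * prob (?E a i))"
    by (intro has_bochner_integral_sum)
  hence g: "?g \<in> borel_measurable M" by (rule borel_measurable_has_bochner_integral)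
  have AE: "AE \<omega> in M. ?f \<omega> = ?g \<omega>"
    using AE_X_in_values[OF t] AE_space
  proof eventually_elim
    case (elim \<omega>)
    then obtain i0 where i0: "i0 \<in> {1..k}" "X t \<omega> = x i0" by auto
    have Y0: "Y \<omega> \<in> A" using elim measurable_space[OF YM] by simp
    have "indicator (?E a i) \<omega> = (if a = Y \<omega> then if i = i0 then 1 else 0 else (0::real))" if "i \<in> {1..k}" for a i
      using elim i0 that by (auto simp: indicator_def x_eq_iff)
    hence "?g \<omega> = (\<Sum>a\<in>A. \<Sum>i=1..k. if a = Y \<omega> then if i = i0 then h a (x i) else 0 else 0)"
      by (intro sum.cong) auto
    also have "... = (\<Sum>a\<in>A. if a = Y \<omega> then h a (x i0) else 0)"
      using i0 by (intro sum.cong) (auto simp: sum.delta)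
    also have "... = ?f \<omega>" using Y0 A i0 by (simp add: sum.delta)
    finally show ?case by simp
  qed
  have "expectation ?f = expectation ?g" using AE f g by (intro integral_cong_AE) auto
  also have "... = (\<Sum>a\<in>A. \<Sum>i=1..k. h a (x i) * prob (?E a i))"
    using hbi by (rule has_bochner_integral_integral_eq)
  also have "... = (\<Sum>a\<in>A. prob (Y -` {a} \<inter> space M) * (\<Sum>i=1..k. p i * h a (x i)))"
    using history_indep[OF t _ Ya] by (auto simp: sum_distrib_left mult_ac intro!: sum.cong)
  finally show "expectation ?f = (\<Sum>a\<in>A. prob (Y -` {a} \<inter> space M) * (\<Sum>i=1..k. p i * h a (x i)))" .
qed

text \<open>The expected reward of optimal play with empty locations \<open>S\<close> and \<open>card S\<close> rounds to go.\<close>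

definition set_value :: "nat set \<Rightarrow> real" where
  "set_value S = (\<Sum>j\<in>S. r j * thr (card S) (int (position_in S j)))"

text \<open>The best conditional expectation once the next value is known to be \<open>y\<close>.\<close>

definition sorted_reward :: "nat set \<Rightarrow> real \<Rightarrow> real" where
  "sorted_reward S y = (\<Sum>j\<in>S. r j *
     clamp_to (thr (card S - 1) (int (position_in S j) - 1)) (thr (card S - 1) (int (position_in S j))) y)"

lemma sorted_reward_measurable: "sorted_reward S \<in> borel_measurable borel"
  unfolding sorted_reward_def[abs_def] by measurable

lemma mix_sorted_reward:
  assumes "finite S"
  shows "(\<Sum>i=1..k. p i * sorted_reward S (x i)) = set_value S"
proof (cases "S = {}")
  case False
  then obtain n where n: "card S = Suc n" using assms by (metis card_eq_0_iff not0_implies_Suc)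
  have "(\<Sum>i=1..k. p i * sorted_reward S (x i))
     = (\<Sum>i=1..k. \<Sum>j\<in>S. r j * (p i * clamp_to (thr n (int (position_in S j) - 1)) (thr n (int (position_in S j))) (x i)))"
    by (simp add: sorted_reward_def n sum_distrib_left mult_ac)
  also have "... = (\<Sum>j\<in>S. r j * thr (Suc n) (int (position_in S j)))"
    by (subst sum.swap) (simp add: sum_distrib_left)
  finally show ?thesis by (simp add: set_value_def n)
qed (simp_all add: sorted_reward_def set_value_def)

context
  fixes S and i
  assumes S: "S \<subseteq> {1..N}" "S \<noteq> {}" and i: "i \<in> {1..k}"
begin

lemma assignment_interp: "assignment S (thr (card S - 1)) r (x i)"
proof
  show "finite S" using S finite_subset by blast
  show "strict_mono_on S r" using monotone_on_subset[OF r_mono S(1)] .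
  show "thr (card S - 1) 0 \<le> x i" using x_le[of 1 i] i by (simp add: thr_low)
  have "0 < card S" using S \<open>finite S\<close> by (simp add: card_gt_0_iff)
  thus "x i \<le> thr (card S - 1) (int (card S))" using x_le[of i k] i by (simp add: thr_high)
qed (rule thr_mono)

lemma choice_le:
  assumes "q \<in> S"
  shows "x i * r q + set_value (S - {q}) \<le> sorted_reward S (x i)"
proof -
  interpret assignment S "thr (card S - 1)" r "x i" by (rule assignment_interp)
  show ?thesis using insertion_le[OF assms, unfolded sorted_value_def] assms fin
    by (simp add: set_value_def sorted_reward_def)
qed

lemma choice_eq_iff:
  assumes "q \<in> S"
  shows "x i * r q + set_value (S - {q}) = sorted_reward S (x i)
    \<longleftrightarrow> thr (card S - 1) (int (position_in S q) - 1) \<le> x i \<and> x i \<le> thr (card S - 1) (int (position_in S q))"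
proof -
  interpret assignment S "thr (card S - 1)" r "x i" by (rule assignment_interp)
  show ?thesis using insertion_eq_iff[OF assms, unfolded sorted_value_def fits_def] assms fin
    by (simp add: set_value_def sorted_reward_def)
qed

end

text \<open>The conditional loss caused by the choice of round \<open>t\<close>, all later rounds being played optimally.\<close>

definition gap :: "(nat \<Rightarrow> 'a \<Rightarrow> nat) \<Rightarrow> nat \<Rightarrow> 'a \<Rightarrow> real" where
  "gap J t \<omega> = sorted_reward (remaining N J (t - 1) \<omega>) (X t \<omega>)
     - (X t \<omega> * r (J t \<omega>) + set_value (remaining N J t \<omega>))"

lemma gap_choice:
  assumes J: "policy M N X J" and t: "t \<in> {1..N}" and w: "\<omega> \<in> space M" and i: "i \<in> {1..k}" "X t \<omega> = x i"
  defines "S \<equiv> remaining N J (t - 1) \<omega>"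
  shows "S \<subseteq> {1..N}" "S \<noteq> {}" "J t \<omega> \<in> S"
    "gap J t \<omega> = sorted_reward S (x i) - (x i * r (J t \<omega>) + set_value (S - {J t \<omega>}))"
proof -
  show "S \<subseteq> {1..N}" by (auto simp: S_def remaining_def)
  show "J t \<omega> \<in> S" using policy_in_remaining[OF J w t] by (simp add: S_def)
  thus "S \<noteq> {}" by auto
  have "remaining N J t \<omega> = S - {J t \<omega>}"
    using remaining_Suc[of N J "t - 1"] t by (simp add: S_def)
  thus "gap J t \<omega> = sorted_reward S (x i) - (x i * r (J t \<omega>) + set_value (S - {J t \<omega>}))"
    using i by (simp add: gap_def S_def)
qed

lemma gap_nonneg:
  assumes "policy M N X J" "t \<in> {1..N}"
  shows "AE \<omega> in M. 0 \<le> gap J t \<omega>"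
  using AE_X_in_values[OF assms(2)] AE_space
proof eventually_elim
  case (elim \<omega>)
  then obtain i where i: "i \<in> {1..k}" "X t \<omega> = x i" by auto
  note g = gap_choice[OF assms elim(2) i]
  show ?case using choice_le[OF g(1,2) i(1) g(3)] g(4) by simp
qed

lemma bounded_integrable:
  assumes t: "t \<in> {1..N}" and Y: "Y \<in> M \<rightarrow>\<^sub>M count_space A" and A: "finite A"
    and h: "\<And>a. h a \<in> borel_measurable borel"
  shows "integrable M (\<lambda>\<omega>. h (Y \<omega>) (X t \<omega>) :: real)"
proof (rule integrable_const_bound)
  note [measurable] = X_measurable[OF t]
  show "(\<lambda>\<omega>. h (Y \<omega>) (X t \<omega>)) \<in> borel_measurable M"
    by (rule measurable_compose_countable'[OF _ Y]) (use h A in \<open>auto intro: countable_finite measurable_compose\<close>)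
  show "AE \<omega> in M. norm (h (Y \<omega>) (X t \<omega>)) \<le> (\<Sum>a\<in>A. \<Sum>i=1..k. \<bar>h a (x i)\<bar>)"
    using AE_X_in_values[OF t] AE_space
  proof eventually_elim
    case (elim \<omega>)
    then obtain i0 where i0: "i0 \<in> {1..k}" "X t \<omega> = x i0" by auto
    have Y0: "Y \<omega> \<in> A" using elim measurable_space[OF Y] by simp
    have "\<bar>h (Y \<omega>) (x i0)\<bar> \<le> (\<Sum>i=1..k. \<bar>h (Y \<omega>) (x i)\<bar>)"
      using i0 by (intro member_le_sum) auto
    also have "... \<le> (\<Sum>a\<in>A. \<Sum>i=1..k. \<bar>h a (x i)\<bar>)"
      using Y0 A by (intro member_le_sum[of _ _ "\<lambda>a. \<Sum>i=1..k. \<bar>h a (x i)\<bar>"] sum_nonneg) auto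
    finally show ?case using i0 by simp
  qed
qed

context
  fixes J assumes J: "policy M N X J"
begin

lemma integrable_parts:
  assumes t: "t \<in> {1..N}"
  shows "integrable M (\<lambda>\<omega>. X t \<omega> * r (J t \<omega>))"
    "integrable M (\<lambda>\<omega>. sorted_reward (remaining N J (t - 1) \<omega>) (X t \<omega>))"
    "integrable M (\<lambda>\<omega>. set_value (remaining N J (t - 1) \<omega>))"
    "integrable M (\<lambda>\<omega>. set_value (remaining N J t \<omega>))"
    "integrable M (gap J t)"
proof -
  have Jt: "J t \<in> M \<rightarrow>\<^sub>M count_space {1..N}"
    using J t by (intro measurable_from_history[of _ t]) (auto simp: policy_def)
  have R: "remaining N J s \<in> M \<rightarrow>\<^sub>M count_space (Pow {1..N})" if "s \<le> N" for s
    using remaining_measurable[OF J that] that by (rule measurable_from_history)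
  have 1: "t - 1 \<le> N" "t \<le> N" using t by auto
  show *: "integrable M (\<lambda>\<omega>. X t \<omega> * r (J t \<omega>))"
    using bounded_integrable[OF t Jt, of "\<lambda>q y. y * r q"] by simp
  show **: "integrable M (\<lambda>\<omega>. sorted_reward (remaining N J (t - 1) \<omega>) (X t \<omega>))"
    by (rule bounded_integrable[OF t R[OF 1(1)], of sorted_reward])
      (simp_all only: sorted_reward_measurable finite_Pow_iff finite_atLeastAtMost)
  show "integrable M (\<lambda>\<omega>. set_value (remaining N J (t - 1) \<omega>))"
    using bounded_integrable[OF t R[OF 1(1)], of "\<lambda>S y. set_value S"] by simp
  show ***: "integrable M (\<lambda>\<omega>. set_value (remaining N J t \<omega>))"
    using bounded_integrable[OF t R[OF 1(2)], of "\<lambda>S y. set_value S"] by simp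
  show "integrable M (gap J t)" unfolding gap_def using * ** *** by auto
qed

text \<open>Averaging over the next value before it is seen: this is where independence and the recursion for
  \<open>thr\<close> enter.\<close>

lemma expectation_sorted_reward:
  assumes t: "t \<in> {1..N}"
  shows "expectation (\<lambda>\<omega>. sorted_reward (remaining N J (t - 1) \<omega>) (X t \<omega>))
    = expectation (\<lambda>\<omega>. set_value (remaining N J (t - 1) \<omega>))"
proof -
  have R: "remaining N J (t - 1) \<in> history M X (t - 1) \<rightarrow>\<^sub>M count_space (Pow {1..N})"
    using t by (intro remaining_measurable[OF J]) auto
  let ?P = "\<lambda>S. prob (remaining N J (t - 1) -` {S} \<inter> space M)"
  have "expectation (\<lambda>\<omega>. sorted_reward (remaining N J (t - 1) \<omega>) (X t \<omega>))
      = (\<Sum>S\<in>Pow {1..N}. ?P S * (\<Sum>i=1..k. p i * sorted_reward S (x i)))"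
    by (rule expectation_mix[OF t R, of sorted_reward])
      (simp_all only: sorted_reward_measurable finite_Pow_iff finite_atLeastAtMost)
  also have "... = (\<Sum>S\<in>Pow {1..N}. ?P S * (\<Sum>i=1..k. p i * set_value S))"
  proof (rule sum.cong)
    fix S assume "S \<in> Pow {1..N}"
    hence "finite S" using finite_subset[of S "{1..N}"] by simp
    thus "?P S * (\<Sum>i=1..k. p i * sorted_reward S (x i)) = ?P S * (\<Sum>i=1..k. p i * set_value S)"
      by (simp only: mix_sorted_reward mix_const)
  qed simp
  also have "... = expectation (\<lambda>\<omega>. set_value (remaining N J (t - 1) \<omega>))"
    using expectation_mix[OF t R, of "\<lambda>S y. set_value S"] by simp
  finally show ?thesis .
qed

text \<open>By \<open>expectation_sorted_reward\<close> the expected gap of round \<open>t\<close> is the drop of the expected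
  \<open>set_value\<close> in that round minus the expected reward collected there; the drops telescope, and nothing
  is left after round \<open>N\<close>.\<close>

lemma expected_reward:
  "expectation (reward N r X J) = set_value {1..N} - (\<Sum>t=1..N. expectation (gap J t))"
proof -
  let ?v = "\<lambda>t. expectation (\<lambda>\<omega>. set_value (remaining N J t \<omega>))"
  have "expectation (gap J t) = ?v (t - 1) - ?v t - expectation (\<lambda>\<omega>. X t \<omega> * r (J t \<omega>))"
    if t: "t \<in> {1..N}" for t
    using integrable_parts[OF t] expectation_sorted_reward[OF t] by (simp add: gap_def[abs_def])
  hence "(\<Sum>t=1..N. expectation (gap J t))
      = (\<Sum>t=1..N. ?v (t - 1) - ?v t) - (\<Sum>t=1..N. expectation (\<lambda>\<omega>. X t \<omega> * r (J t \<omega>)))"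
    by (simp add: sum_subtractf)
  also have "(\<Sum>t=1..N. ?v (t - 1) - ?v t) = ?v 0 - ?v N"
    using sum_telescope''[of 0 N "\<lambda>t. - ?v t"] by (simp add: sum_negf)
  also have "?v 0 = set_value {1..N}" by (simp add: prob_space)
  also have "?v N = expectation (\<lambda>_. 0)"
    by (intro Bochner_Integration.integral_cong) (auto simp: remaining_final[OF J] set_value_def)
  also have "(\<Sum>t=1..N. expectation (\<lambda>\<omega>. X t \<omega> * r (J t \<omega>))) = expectation (reward N r X J)"
    unfolding reward_def using integrable_parts(1)
    by (subst Bochner_Integration.integral_sum) auto
  finally show ?thesis by simp
qed

end

text \<open>The choice of \<open>least_fits\<close> for the thresholds of the problem.\<close>

definition select :: "nat set \<Rightarrow> real \<Rightarrow> nat" where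
  "select S y = (LEAST q. q \<in> S \<and> (y \<le> thr (card S - 1) (int (position_in S q)) \<or> (\<forall>s\<in>S. s \<le> q)))"

fun dlr_remaining :: "nat \<Rightarrow> 'a \<Rightarrow> nat set" where
  "dlr_remaining 0 \<omega> = {1..N}"
| "dlr_remaining (Suc t) \<omega> = dlr_remaining t \<omega> - {select (dlr_remaining t \<omega>) (X (Suc t) \<omega>)}"

definition dlr_policy :: "nat \<Rightarrow> 'a \<Rightarrow> nat" where
  "dlr_policy t \<omega> = select (dlr_remaining (t - 1) \<omega>) (X t \<omega>)"

lemma select_in:
  assumes "finite S" "S \<noteq> {}"
  shows "select S y \<in> S"
proof -
  have "select S y \<in> S \<and> (y \<le> thr (card S - 1) (int (position_in S (select S y))) \<or> (\<forall>s\<in>S. s \<le> select S y))"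
    unfolding select_def by (rule LeastI[of _ "Max S"]) (use assms in auto)
  thus ?thesis ..
qed

lemma select_measurable: "select S \<in> borel \<rightarrow>\<^sub>M count_space UNIV"
  unfolding select_def by measurable

text \<open>The last clause identifies the recursively defined sets with the empty locations of the policy, so
  the gaps of \<open>dlr_policy\<close> can be computed by \<open>gap_choice\<close>.\<close>

lemma dlr_remaining_props:
  assumes "t \<le> N"
  shows "dlr_remaining t \<omega> \<subseteq> {1..N}" "card (dlr_remaining t \<omega>) = N - t"
    "remaining N dlr_policy t \<omega> = dlr_remaining t \<omega>"
  using assms
proof (induction t)
  case (Suc t)
  { case 1 thus ?case using Suc by auto }
  { case 2
    have "finite (dlr_remaining t \<omega>)" using Suc.IH(1) 2 finite_subset[of _ "{1..N}"] by auto
    moreover have "dlr_remaining t \<omega> \<noteq> {}" using Suc.IH(2) 2 by auto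
    ultimately show ?case using Suc.IH(2) 2 select_in[of "dlr_remaining t \<omega>"] by simp }
  { case 3 thus ?case using Suc.IH(3) by (simp add: remaining_Suc dlr_policy_def) }
qed auto

lemma dlr_policy_in:
  assumes "t \<in> {1..N}"
  shows "dlr_policy t \<omega> \<in> dlr_remaining (t - 1) \<omega>"
proof -
  have t: "t - 1 \<le> N" "N - (t - 1) \<noteq> 0" using assms by auto
  have "finite (dlr_remaining (t - 1) \<omega>)"
    using dlr_remaining_props(1)[OF t(1)] by (rule finite_subset) simp
  moreover have "dlr_remaining (t - 1) \<omega> \<noteq> {}"
    using dlr_remaining_props(2)[OF t(1), of \<omega>] t(2) by auto
  ultimately show ?thesis unfolding dlr_policy_def by (rule select_in)
qed

lemma dlr_remaining_measurable:
  "t \<le> N \<Longrightarrow> dlr_remaining t \<in> history M X t \<rightarrow>\<^sub>M count_space (Pow {1..N})"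
proof (induction t)
  case (Suc t)
  have "(\<lambda>\<omega>. dlr_remaining t \<omega> - {select (dlr_remaining t \<omega>) (X (Suc t) \<omega>)})
      \<in> history M X (Suc t) \<rightarrow>\<^sub>M count_space (Pow {1..N})"
  proof (rule measurable_remove_chosen[where g = "\<lambda>S \<omega>. select S (X (Suc t) \<omega>)"])
    show "dlr_remaining t \<in> history M X (Suc t) \<rightarrow>\<^sub>M count_space (Pow {1..N})"
      by (rule measurable_history_mono[of "dlr_remaining t" M X t]) (use Suc in simp_all)
  qed (intro measurable_compose[OF measurable_history select_measurable], simp)
  thus ?case by simp
next
  case 0
  have "(\<lambda>\<omega>. {1..N}) \<in> history M X 0 \<rightarrow>\<^sub>M count_space (Pow {1..N})" by simp
  thus ?case by (subst measurable_cong[where g = "\<lambda>_. {1..N}"]) auto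
qed

lemma dlr_policy_policy: "policy M N X dlr_policy"
  unfolding policy_def
proof (intro conjI ballI)
  fix t assume t: "t \<in> {1..N}"
  have "dlr_policy t \<in> history M X t \<rightarrow>\<^sub>M count_space UNIV"
    unfolding dlr_policy_def
  proof (rule measurable_compose_countable'[where g = "dlr_remaining (t - 1)" and I = "Pow {1..N}"])
    show "dlr_remaining (t - 1) \<in> history M X t \<rightarrow>\<^sub>M count_space (Pow {1..N})"
      using t by (intro measurable_history_mono[OF dlr_remaining_measurable]) auto
    show "(\<lambda>\<omega>. select S (X t \<omega>)) \<in> history M X t \<rightarrow>\<^sub>M count_space UNIV" for S
      using t by (intro measurable_compose[OF measurable_history select_measurable]) auto
  qed (auto intro: countable_finite)
  moreover have "dlr_policy t \<omega> \<in> {1..N}" for \<omega>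
  proof -
    have "t - 1 \<le> N" using t by auto
    thus ?thesis using dlr_policy_in[OF t, of \<omega>] dlr_remaining_props(1)[of "t - 1" \<omega>] by blast
  qed
  ultimately show "dlr_policy t \<in> history M X t \<rightarrow>\<^sub>M count_space {1..N}"
    using measurable_count_space_extend[of "{1..N}" UNIV "dlr_policy t" "history M X t"] by simp
next
  fix \<omega>
  have "dlr_policy s \<omega> \<noteq> dlr_policy t \<omega>" if "s \<in> {1..N}" "t \<in> {1..N}" "s < t" for s t
  proof -
    have "dlr_policy t \<omega> \<in> remaining N dlr_policy (t - 1) \<omega>"
      using dlr_policy_in[OF that(2), of \<omega>] dlr_remaining_props(3)[of "t - 1" \<omega>] that(2) by auto
    hence "dlr_policy t \<omega> \<notin> (\<lambda>s. dlr_policy s \<omega>) ` {1..t - 1}" by (simp add: remaining_def)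
    moreover have "dlr_policy s \<omega> \<in> (\<lambda>s. dlr_policy s \<omega>) ` {1..t - 1}" using that by (intro imageI) auto
    ultimately show ?thesis by metis
  qed
  thus "inj_on (\<lambda>t. dlr_policy t \<omega>) {1..N}" by (rule linorder_inj_onI) auto
qed

lemma dlr_gap:
  assumes t: "t \<in> {1..N}"
  shows "AE \<omega> in M. gap dlr_policy t \<omega> = 0"
  using AE_X_in_values[OF t] AE_space
proof eventually_elim
  case (elim \<omega>)
  then obtain i where i: "i \<in> {1..k}" "X t \<omega> = x i" by auto
  define S where "S = remaining N dlr_policy (t - 1) \<omega>"
  note g = gap_choice[OF dlr_policy_policy t elim(2) i, folded S_def]
  interpret assignment S "thr (card S - 1)" r "x i" by (rule assignment_interp[OF g(1,2) i(1)])
  have "dlr_policy t \<omega> = select S (x i)"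
  proof -
    have "t - 1 \<le> N" using t by auto
    thus ?thesis using dlr_remaining_props(3)[of "t - 1" \<omega>] i by (simp only: dlr_policy_def S_def)
  qed
  hence "fits (dlr_policy t \<omega>)" using least_fits(2)[OF g(2)] by (simp add: select_def)
  hence "x i * r (dlr_policy t \<omega>) + set_value (S - {dlr_policy t \<omega>}) = sorted_reward S (x i)"
    unfolding fits_def choice_eq_iff[OF g(1,2) i(1) g(3)] .
  thus ?case using g(4) by simp
qed

text \<open>The threshold policy has no gaps and attains \<open>set_value {1..N}\<close>; an optimal policy must attain it
  too, so its nonnegative gaps have expectation zero.\<close>

lemma optimal_gap_zero:
  assumes J: "optimal_policy M N r X J" and t: "t \<in> {1..N}"
  shows "AE \<omega> in M. gap J t \<omega> = 0"
proof -
  have pol: "policy M N X J" using J by (simp add: optimal_policy_def)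
  have "expectation (gap dlr_policy s) = 0" if "s \<in> {1..N}" for s
    using integral_eq_zero_AE[OF dlr_gap[OF that]] .
  hence "set_value {1..N} = expectation (reward N r X dlr_policy)"
    using expected_reward[OF dlr_policy_policy] by simp
  also have "... \<le> expectation (reward N r X J)"
    using J dlr_policy_policy by (simp add: optimal_policy_def)
  finally have le: "(\<Sum>s=1..N. expectation (gap J s)) \<le> 0" using expected_reward[OF pol] by simp
  have nonneg: "0 \<le> expectation (gap J s)" if "s \<in> {1..N}" for s
    by (rule integral_nonneg_AE[OF gap_nonneg[OF pol that]])
  hence "(\<Sum>s=1..N. expectation (gap J s)) = 0" using le by (intro antisym sum_nonneg) auto
  hence "expectation (gap J t) = 0" using nonneg t by (subst (asm) sum_nonneg_eq_0_iff) auto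
  thus ?thesis
    using integral_nonneg_eq_0_iff_AE[OF integrable_parts(5)[OF pol t] gap_nonneg[OF pol t]] by simp
qed

text \<open>The event \<open>X 1 = x i\<close> has positive probability, so it contains an outcome at which the first gap
  vanishes; the equality case of the rearrangement inequality then locates \<open>l\<close>.\<close>

lemma optimal_location_between:
  assumes loc: "optimal_location M N r X (x i) l" and i: "i \<in> {1..k}" and N: "1 \<le> N"
  shows "thr (N - 1) (int l - 1) \<le> x i \<and> x i \<le> thr (N - 1) (int l)"
proof -
  obtain J where J: "optimal_policy M N r X J" "\<And>\<omega>. \<omega> \<in> space M \<Longrightarrow> X 1 \<omega> = x i \<Longrightarrow> J 1 \<omega> = l"
    and l: "l \<in> {1..N}"
    using loc by (auto simp: optimal_location_def)
  have pol: "policy M N X J" using J by (simp add: optimal_policy_def)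
  have t: "1 \<in> {1..N}" using N by simp
  have "\<exists>\<omega>\<in>space M. X 1 \<omega> = x i \<and> gap J 1 \<omega> = 0"
  proof (rule ccontr)
    assume none: "\<not> (\<exists>\<omega>\<in>space M. X 1 \<omega> = x i \<and> gap J 1 \<omega> = 0)"
    have "AE \<omega> in M. X 1 \<omega> \<noteq> x i"
      using optimal_gap_zero[OF J(1) t] AE_space by eventually_elim (use none in blast)
    hence "prob {\<omega> \<in> space M. X 1 \<omega> = x i} = 0"
      using X_measurable[OF t] by (subst prob_eq_0) auto
    thus False using X_prob[OF t i] p_pos[OF i] by simp
  qed
  then obtain \<omega> where w: "\<omega> \<in> space M" "X 1 \<omega> = x i" "gap J 1 \<omega> = 0" by blast
  note g = gap_choice[OF pol t w(1) i w(2)]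
  have "x i * r l + set_value ({1..N} - {l}) = sorted_reward {1..N} (x i)"
    using g(4) w J(2) by simp
  moreover have "position_in {1..N} l = l" using l position_atLeastAtMost[of N l] by simp
  ultimately show ?thesis using choice_eq_iff[of "{1..N}", OF _ _ i l] l by (simp del: One_nat_def)
qed

end

section \<open>Asymptotics of the optimal locations\<close>

theorem theorem1p2:
  fixes k :: nat and x p :: "nat \<Rightarrow> real"
    and M :: "nat \<Rightarrow> 'a measure" and X :: "nat \<Rightarrow> nat \<Rightarrow> 'a \<Rightarrow> real"
    and r :: "nat \<Rightarrow> nat \<Rightarrow> real" and l :: "nat \<Rightarrow> nat \<Rightarrow> nat"
  assumes "k \<ge> 3"
    and "strict_mono_on {1..k} x"
    and "\<And>i. i \<in> {1..k} \<Longrightarrow> p i > 0"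
    and "(\<Sum>i = 1..k. p i) = 1"
    and "\<And>N. N \<ge> 1 \<Longrightarrow> iid_with_pmf (M N) N k x p (X N)"
    and "\<And>N. N \<ge> 1 \<Longrightarrow> strict_mono_on {1..N} (r N)"
    and "\<And>N i. N \<ge> 1 \<Longrightarrow> i \<in> {1..k} \<Longrightarrow> optimal_location (M N) N (r N) (X N) (x i) (l N i)"
  shows "\<forall>i\<in>{1..k}. \<exists>\<epsilon> \<in> o(\<lambda>_::nat. 1::real).
           \<forall>N\<ge>1. real (l N i) = real N * (limit_location k p i + \<epsilon> N)"
proof
  fix i assume i: "i \<in> {1..k}"
  interpret finite_distribution k x p by standard (use assms(1-4) in auto)
  have loc: "thr (N - 1) (int (l N i) - 1) \<le> x i \<and> x i \<le> thr (N - 1) (int (l N i))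
      \<and> 1 \<le> l N i \<and> l N i \<le> N" if N: "1 \<le> N" for N
  proof -
    interpret prob_space "M N" using assms(5)[OF N] by (simp add: iid_with_pmf_def)
    interpret sequential_assignment k x p "M N" N "X N" "r N"
      by standard (use assms(5,6)[OF N] in auto)
    show ?thesis
      using optimal_location_between[OF assms(7)[OF N i] i N] assms(7)[OF N i]
      by (auto simp: optimal_location_def)
  qed
  have "(\<lambda>m. real (l (Suc m) i) / real (Suc m)) \<longlonglongrightarrow> limit_location k p i"
    using loc[of "Suc m" for m] by (intro location_limit[OF i, of "\<lambda>m. l (Suc m) i"]) simp
  hence lim: "(\<lambda>N. real (l N i) / real N) \<longlonglongrightarrow> limit_location k p i"
    by (rule LIMSEQ_imp_Suc)
  define \<epsilon> where "\<epsilon> N = real (l N i) / real N - limit_location k p i" for N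
  have "\<epsilon> \<longlonglongrightarrow> 0" using tendsto_diff[OF lim tendsto_const[of "limit_location k p i"]] by (simp add: \<epsilon>_def[abs_def])
  hence "\<epsilon> \<in> o(\<lambda>_. 1)" by (intro smalloI_tendsto) auto
  moreover have "\<forall>N\<ge>1. real (l N i) = real N * (limit_location k p i + \<epsilon> N)" by (simp add: \<epsilon>_def)
  ultimately show "\<exists>\<epsilon> \<in> o(\<lambda>_::nat. 1::real).
      \<forall>N\<ge>1. real (l N i) = real N * (limit_location k p i + \<epsilon> N)" by blast
qed

end
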